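(* Let $\mathcal H=\bigotimes_{j=1}^n\mathbb C^{d_j}$, let $S_1,\dots,S_r$ be subsets of $[n]$ with associated matrix $\Sigma=[\sigma_{ij}]$ ($\sigma_{ij}=-1$ if $j\in S_i$, $+1$ otherwise), and let $D_1,\dots,D_r$ be subspaces of $\mathcal H$ with $k_i=\dim D_i^\perp$. If $$\prod_{i=1}^r(\sigma_{i,1}\alpha_1+\sigma_{i,2}\alpha_2+\cdots+\sigma_{i,n}\alpha_n)^{k_i}\neq 0$$ in the ring $\mathbb Z[\alpha_1,\dots,\alpha_n]/(\alpha_1^{d_1},\dots,\alpha_n^{d_n})$, then there exists a nonzero product vector $\ket\psi=\ket{\psi_1}\otimes\cdots\otimes\ket{\psi_n}\in\mathcal H$ with $\ket\psi^{\Gamma(S_i)}\in D_i$ for all $i=1,\dots,r$.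
   Context: For $S\subseteq[n]$ and a product vector $\ket\psi=\ket{\psi_1}\otimes\cdots\otimes\ket{\psi_n}$, $\ket\psi^{\Gamma(S)}$ is the product vector obtained by replacing $\ket{\psi_j}$ with its complex conjugate $\ket{\bar\psi_j}$ for each $j\in S$ and leaving the other factors unchanged. $D^\perp$ denotes the orthogonal complement in $\mathcal H$. *)

theory Defs
  imports "HOL-Analysis.Analysis" "HOL-Library.Function_Algebras" "HOL-Library.Poly_Mapping"
begin

text \<open>Tensor product space H = C^{d_0} (x) ... (x) C^{d_(n-1)} (indices 0..n-1 instead of 1..n).
  Vectors are functions on multi-indices x with x j < d j for j < n, vanishing elsewhere.\<close>

definition idx :: "nat \<Rightarrow> (nat \<Rightarrow> nat) \<Rightarrow> (nat \<Rightarrow> nat) set" where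
  "idx n d = PiE {..<n} (\<lambda>j. {..<d j})"

type_synonym hvec = "(nat \<Rightarrow> nat) \<Rightarrow> complex"

definition Hspace :: "nat \<Rightarrow> (nat \<Rightarrow> nat) \<Rightarrow> hvec set" where
  "Hspace n d = {v. \<forall>x. x \<notin> idx n d \<longrightarrow> v x = 0}"

definition cscale :: "complex \<Rightarrow> hvec \<Rightarrow> hvec" where
  "cscale c v = (\<lambda>x. c * v x)"

definition hinner :: "nat \<Rightarrow> (nat \<Rightarrow> nat) \<Rightarrow> hvec \<Rightarrow> hvec \<Rightarrow> complex" where
  "hinner n d v w = (\<Sum>x\<in>idx n d. cnj (v x) * w x)"

definition is_subspace_H :: "nat \<Rightarrow> (nat \<Rightarrow> nat) \<Rightarrow> hvec set \<Rightarrow> bool" where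
  "is_subspace_H n d D \<longleftrightarrow> D \<subseteq> Hspace n d \<and> module.subspace cscale D"

definition orth_compl :: "nat \<Rightarrow> (nat \<Rightarrow> nat) \<Rightarrow> hvec set \<Rightarrow> hvec set" where
  "orth_compl n d D = {w \<in> Hspace n d. \<forall>v\<in>D. hinner n d v w = 0}"

definition cdim :: "hvec set \<Rightarrow> nat" where
  "cdim V = vector_space.dim cscale V"

definition local_vecs :: "nat \<Rightarrow> (nat \<Rightarrow> nat) \<Rightarrow> (nat \<Rightarrow> nat \<Rightarrow> complex) \<Rightarrow> bool" where
  "local_vecs n d \<psi> \<longleftrightarrow> (\<forall>j<n. \<forall>t. d j \<le> t \<longrightarrow> \<psi> j t = 0)"

definition prodvec :: "nat \<Rightarrow> (nat \<Rightarrow> nat) \<Rightarrow> (nat \<Rightarrow> nat \<Rightarrow> complex) \<Rightarrow> hvec" where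
  "prodvec n d \<psi> = (\<lambda>x. if x \<in> idx n d then (\<Prod>j<n. \<psi> j (x j)) else 0)"

definition pconj :: "nat set \<Rightarrow> (nat \<Rightarrow> nat \<Rightarrow> complex) \<Rightarrow> (nat \<Rightarrow> nat \<Rightarrow> complex)" where
  "pconj S \<psi> = (\<lambda>j t. if j \<in> S then cnj (\<psi> j t) else \<psi> j t)"

definition sigma :: "(nat \<Rightarrow> nat set) \<Rightarrow> nat \<Rightarrow> nat \<Rightarrow> int" where
  "sigma S i j = (if j \<in> S i then -1 else 1)"

text \<open>Multivariate integer polynomials Z[alpha_0,...] as poly_mappings from monomials
  (exponent vectors) to coefficients; alpha j is the variable.\<close>
type_synonym ipoly = "(nat \<Rightarrow>\<^sub>0 nat) \<Rightarrow>\<^sub>0 int"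

definition alpha :: "nat \<Rightarrow> ipoly" where
  "alpha j = Poly_Mapping.single (Poly_Mapping.single j 1) 1"

definition trunc_ideal :: "nat \<Rightarrow> (nat \<Rightarrow> nat) \<Rightarrow> ipoly set" where
  "trunc_ideal n d = module.span ((*) :: ipoly \<Rightarrow> ipoly \<Rightarrow> ipoly) {alpha j ^ d j | j. j < n}"

definition nonzero_in_quotient :: "nat \<Rightarrow> (nat \<Rightarrow> nat) \<Rightarrow> ipoly \<Rightarrow> bool" where
  "nonzero_in_quotient n d p \<longleftrightarrow> p \<notin> trunc_ideal n d"

end

theory Submission
  imports Defs "HOL-Computational_Algebra.Polynomial"
begin

text \<open>The coefficient of a monomial \<open>\<alpha>\<^sup>m\<close> with all \<open>m\<^sub>j < d\<^sub>j\<close> is nonzero. Take for \<open>\<psi>\<^sub>j\<close> the coefficient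
  vector of a product of \<open>m\<^sub>j\<close> linear polynomials in one variable. The orthogonality conditions become
  \<open>K = \<Sum>k\<^sub>i\<close> equations in \<open>K\<close> points of the Riemann sphere, linear or antilinear in each, and the
  permanent of their sign matrix is \<open>\<Prod>m\<^sub>j!\<close> times the coefficient, hence nonzero. Each sphere is a
  square with its boundary collapsed: on the boundary of square \<open>b\<close> equation \<open>e\<close> is \<open>z\<^sub>b\<close> or its
  conjugate times a function independent of \<open>z\<^sub>b\<close>.

  If there were no common zero, consider on a fine grid the cochain \<open>a\<^sub>e\<close> recording the change of
  argument of equation \<open>e\<close> along the edges. Its curvature vanishes on every cube on which equation \<open>e\<close>
  stays away from zero; as every cube has such an \<open>e\<close>, the product of all the
  curvatures is zero. But by the discrete Stokes theorem the sum of that product over the grid is the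
  permanent times a nonzero constant, a discrete form of the integral of a product of Chern classes.\<close>

section \<open>Cubical forms\<close>

text \<open>A form assigns to a lattice point the coefficients of \<open>dx\<^sub>K\<close> for all finite sets \<open>K\<close> of
  directions, and \<open>esign k K\<close> is the sign in \<open>dx\<^sub>k \<and> dx\<^bsub>K-k\<^esub> = \<plusminus> dx\<^sub>K\<close>. In \<open>wdg\<close> the second factor is
  taken at the far end of the edge, as in the cup product; this makes the Leibniz rule exact.\<close>

type_synonym lform = "nat set \<Rightarrow> (nat \<Rightarrow> nat) \<Rightarrow> real"

definition bump :: "nat \<Rightarrow> (nat \<Rightarrow> nat) \<Rightarrow> nat \<Rightarrow> nat" where
  "bump k x = x(k := Suc (x k))"

definition esign :: "nat \<Rightarrow> nat set \<Rightarrow> real" where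
  "esign k K = (-1) ^ card {l \<in> K. l < k}"

definition dif :: "lform \<Rightarrow> lform" where
  "dif \<phi> K x = (\<Sum>k\<in>K. esign k K * (\<phi> (K - {k}) (bump k x) - \<phi> (K - {k}) x))"

definition wdg :: "(nat \<Rightarrow> (nat \<Rightarrow> nat) \<Rightarrow> real) \<Rightarrow> lform \<Rightarrow> lform" where
  "wdg a \<phi> K x = (\<Sum>k\<in>K. esign k K * (a k x * \<phi> (K - {k}) (bump k x)))"

text \<open>As every \<open>chern as\<close> is closed, \<open>chern (a # as)\<close> is the curvature of \<open>a\<close> wedge \<open>chern as\<close>
  (lemma \<open>chern_Cons_curv\<close>).\<close>

fun chern :: "(nat \<Rightarrow> (nat \<Rightarrow> nat) \<Rightarrow> real) list \<Rightarrow> lform" where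
  "chern [] = (\<lambda>K x. if K = {} then 1 else 0)"
| "chern (a # as) = dif (wdg a (chern as))"

definition curv :: "(nat \<Rightarrow> (nat \<Rightarrow> nat) \<Rightarrow> real) \<Rightarrow> nat \<Rightarrow> nat \<Rightarrow> (nat \<Rightarrow> nat) \<Rightarrow> real" where
  "curv a k l x = a l (bump k x) + a k x - a k (bump l x) - a l x"

section \<open>Signs, closed forms and the curvature expansion\<close>

lemma Diff_swap: "A - {k} - {l} = A - {l} - {k}"
  by auto

lemma bump_commute: "bump k (bump l x) = bump l (bump k x)"
  by (auto simp: bump_def fun_eq_iff)

text \<open>Removing the smaller direction \<open>k\<close> lowers the position of \<open>l\<close>
  by one; removing \<open>l\<close> leaves that of \<open>k\<close> unchanged.\<close>

lemma esign_antisym_less: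
  assumes "finite K" "k \<in> K" "l \<in> K" "k < l"
  shows "esign k K * esign l (K - {k}) = - (esign l K * esign k (K - {l}))"
proof -
  have 1: "{p \<in> K - {l}. p < k} = {p \<in> K. p < k}" using assms by auto
  have 2: "{p \<in> K. p < l} = insert k {p \<in> K - {k}. p < l}" using assms by auto
  have "card {p \<in> K. p < l} = Suc (card {p \<in> K - {k}. p < l})"
    unfolding 2 using assms by (subst card_insert_disjoint) auto
  then show ?thesis unfolding esign_def 1 by simp
qed

lemma esign_antisym:
  assumes "finite K" "k \<in> K" "l \<in> K" "k \<noteq> l"
  shows "esign k K * esign l (K - {k}) = - (esign l K * esign k (K - {l}))"
  using esign_antisym_less[of K k l] esign_antisym_less[of K l k] assms by force

lemma sum_off_diagonal_swap:
  fixes h :: "nat \<Rightarrow> nat \<Rightarrow> real"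
  assumes "finite K"
  shows "(\<Sum>k\<in>K. \<Sum>l\<in>K - {k}. h k l) = (\<Sum>k\<in>K. \<Sum>l\<in>K - {k}. h l k)"
proof -
  have e: "(\<Sum>k\<in>K. \<Sum>l\<in>K - {k}. g k l) = (\<Sum>k\<in>K. \<Sum>l\<in>K. if k = l then 0 else g k l)"
    for g :: "nat \<Rightarrow> nat \<Rightarrow> real"
    by (intro sum.cong sum.mono_neutral_cong_left) (use assms in auto)
  show ?thesis unfolding e by (subst sum.swap) (auto intro!: sum.cong)
qed

lemma esign_sum_symmetric_zero:
  assumes "finite K"
    and "\<And>k l. k \<in> K \<Longrightarrow> l \<in> K \<Longrightarrow> k \<noteq> l \<Longrightarrow> G k l = G l k"
  shows "(\<Sum>k\<in>K. \<Sum>l\<in>K - {k}. esign k K * esign l (K - {k}) * G k l) = 0" (is "?S = 0")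
proof -
  have "?S = (\<Sum>k\<in>K. \<Sum>l\<in>K - {k}. esign l K * esign k (K - {l}) * G l k)"
    by (rule sum_off_diagonal_swap[OF assms(1)])
  also have "\<dots> = (\<Sum>k\<in>K. \<Sum>l\<in>K - {k}. - (esign k K * esign l (K - {k}) * G k l))"
    using esign_antisym[OF assms(1)] assms(2) by (intro sum.cong refl) fastforce
  also have "\<dots> = - ?S" by (simp add: sum_negf)
  finally show ?thesis by simp
qed

lemma dif_dif:
  assumes "finite K" shows "dif (dif \<phi>) K x = 0"
proof -
  have "dif (dif \<phi>) K x = (\<Sum>k\<in>K. \<Sum>l\<in>K - {k}. esign k K * esign l (K - {k}) *
     (\<phi> (K - {k} - {l}) (bump l (bump k x)) - \<phi> (K - {k} - {l}) (bump k x)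
      - \<phi> (K - {k} - {l}) (bump l x) + \<phi> (K - {k} - {l}) x))"
    unfolding dif_def
    by (simp add: sum_distrib_left sum_subtractf[symmetric] algebra_simps)
  also have "\<dots> = 0"
    by (rule esign_sum_symmetric_zero[OF assms])
      (simp add: bump_commute Diff_swap)
  finally show ?thesis .
qed

lemma dif_chern: "finite K \<Longrightarrow> dif (chern as) K x = 0"
  by (cases as) (auto simp: dif_dif, auto simp: dif_def)

text \<open>Two vanishing sums are added to the definition: one is 0 because \<open>chern as\<close>
  is closed, the other because it is symmetric in \<open>k\<close> and \<open>l\<close>. Afterwards
  \<open>chern as\<close> is evaluated only at the far corner.\<close>

lemma chern_Cons:
  assumes "finite K"
  shows "chern (a # as) K x = (\<Sum>k\<in>K. \<Sum>l\<in>K - {k}. esign k K * esign l (K - {k}) *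
     ((a l (bump k x) + a k x) * chern as (K - {k} - {l}) (bump l (bump k x))))"
proof -
  let ?\<phi> = "chern as" and ?s = "\<lambda>k l. esign k K * esign l (K - {k})"
  let ?W = "\<lambda>k l. K - {k} - {l}"
  have A: "chern (a # as) K x = (\<Sum>k\<in>K. \<Sum>l\<in>K - {k}. ?s k l *
      (a l (bump k x) * ?\<phi> (?W k l) (bump l (bump k x)) - a l x * ?\<phi> (?W k l) (bump l x)))"
    by (simp add: dif_def wdg_def sum_distrib_left sum_subtractf[symmetric] algebra_simps)
  have "wdg a (dif ?\<phi>) K x = 0"
    using assms by (simp add: wdg_def dif_chern)
  moreover have "wdg a (dif ?\<phi>) K x = (\<Sum>k\<in>K. \<Sum>l\<in>K - {k}. ?s k l *
      (a k x * ?\<phi> (?W k l) (bump l (bump k x)) - a k x * ?\<phi> (?W k l) (bump k x)))"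
    by (simp add: dif_def wdg_def sum_distrib_left sum_subtractf[symmetric] algebra_simps)
  ultimately have B: "(\<Sum>k\<in>K. \<Sum>l\<in>K - {k}. ?s k l *
      (a k x * ?\<phi> (?W k l) (bump l (bump k x)) - a k x * ?\<phi> (?W k l) (bump k x))) = 0" by simp
  have C: "(\<Sum>k\<in>K. \<Sum>l\<in>K - {k}. ?s k l *
      (a l x * ?\<phi> (?W k l) (bump l x) + a k x * ?\<phi> (?W k l) (bump k x))) = 0"
    by (rule esign_sum_symmetric_zero[OF assms])
      (simp add: Diff_swap)
  have "chern (a # as) K x = (\<Sum>k\<in>K. \<Sum>l\<in>K - {k}. ?s k l *
      (a l (bump k x) * ?\<phi> (?W k l) (bump l (bump k x)) - a l x * ?\<phi> (?W k l) (bump l x)))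
     + (\<Sum>k\<in>K. \<Sum>l\<in>K - {k}. ?s k l *
      (a k x * ?\<phi> (?W k l) (bump l (bump k x)) - a k x * ?\<phi> (?W k l) (bump k x)))
     + (\<Sum>k\<in>K. \<Sum>l\<in>K - {k}. ?s k l *
      (a l x * ?\<phi> (?W k l) (bump l x) + a k x * ?\<phi> (?W k l) (bump k x)))"
    unfolding A B C by simp
  then show ?thesis
    by (simp add: sum.distrib[symmetric] algebra_simps del: chern.simps)
qed

text \<open>Adding the sum with \<open>k\<close> and \<open>l\<close> exchanged antisymmetrizes the
  coefficient, which becomes the circulation of \<open>a\<close> around an elementary square. The
  factor 2 counts each unordered pair twice.\<close>

lemma chern_Cons_curv:
  assumes "finite K"
  shows "2 * chern (a # as) K x = (\<Sum>k\<in>K. \<Sum>l\<in>K - {k}. esign k K * esign l (K - {k}) *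
     (curv a k l x * chern as (K - {k} - {l}) (bump l (bump k x))))" (is "_ = ?R")
proof -
  let ?G = "\<lambda>k l. (a l (bump k x) + a k x) * chern as (K - {k} - {l}) (bump l (bump k x))"
  have "chern (a # as) K x =
      (\<Sum>k\<in>K. \<Sum>l\<in>K - {k}. esign l K * esign k (K - {l}) * ?G l k)"
    unfolding chern_Cons[OF assms] by (rule sum_off_diagonal_swap[OF assms])
  also have "\<dots> = (\<Sum>k\<in>K. \<Sum>l\<in>K - {k}. esign k K * esign l (K - {k}) * (- ?G l k))"
    using esign_antisym[OF assms] by (intro sum.cong refl) fastforce
  finally have "2 * chern (a # as) K x =
     (\<Sum>k\<in>K. \<Sum>l\<in>K - {k}. esign k K * esign l (K - {k}) * ?G k l) +
     (\<Sum>k\<in>K. \<Sum>l\<in>K - {k}. esign k K * esign l (K - {k}) * (- ?G l k))"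
    using chern_Cons[OF assms, of a as x] by linarith
  also have "\<dots> = (\<Sum>k\<in>K. \<Sum>l\<in>K - {k}. esign k K * esign l (K - {k}) * (?G k l - ?G l k))"
    by (simp add: sum.distrib[symmetric] algebra_simps)
  also have "\<dots> = ?R"
    by (intro sum.cong refl)
      (simp add: curv_def bump_commute Diff_swap algebra_simps)
  finally show ?thesis .
qed

text \<open>Every term of the full expansion contains a curvature of \<open>a\<close>, at a vertex
  \<open>y\<close> of the cube reached by steps in directions other than \<open>k\<close> and
  \<open>l\<close>; hence the premises \<open>y k = x k\<close> and
  \<open>y l = x l\<close>.\<close>

lemma chern_zero_on_flat_cube:
  assumes "finite K" "a \<in> set as"
    and "\<And>y k l. \<lbrakk>\<forall>p. y p = x p \<or> p \<in> K \<and> y p = Suc (x p);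
        k \<in> K; l \<in> K; y k = x k; y l = x l; k \<noteq> l\<rbrakk> \<Longrightarrow> curv a k l y = 0"
  shows "chern as K x = 0"
  using assms
proof (induction as arbitrary: K x)
  case (Cons b as)
  have "curv b k l x * chern as (K - {k} - {l}) (bump l (bump k x)) = 0"
    if kl: "k \<in> K" "l \<in> K - {k}" for k l
  proof (cases "a = b")
    case True
    then show ?thesis using Cons.prems(3)[of x k l] kl by auto
  next
    case False
    have "chern as (K - {k} - {l}) (bump l (bump k x)) = 0"
    proof (rule Cons.IH)
      show "finite (K - {k} - {l})" using Cons.prems by simp
      show "a \<in> set as" using Cons.prems False by simp
      fix y p q
      assume y: "\<forall>r. y r = bump l (bump k x) r \<or> r \<in> K - {k} - {l} \<and> y r = Suc (bump l (bump k x) r)"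
        and pq: "p \<in> K - {k} - {l}" "q \<in> K - {k} - {l}" "y p = bump l (bump k x) p"
          "y q = bump l (bump k x) q" "p \<noteq> q"
      have "y r = x r \<or> r \<in> K \<and> y r = Suc (x r)" for r
        using spec[OF y, of r] kl by (auto simp: bump_def split: if_splits)
      then show "curv a p q y = 0" using Cons.prems(3) pq by (simp add: bump_def)
    qed
    then show ?thesis by simp
  qed
  then have "2 * chern (b # as) K x = 0"
    unfolding chern_Cons_curv[OF Cons.prems(1)] by (intro sum.neutral ballI) simp
  then show ?case by simp
qed simp

text \<open>Directions \<open>2 j\<close> and \<open>2 j + 1\<close> span square \<open>j\<close>. An adapted cochain behaves like a connection on
  the product of the squares with collapsed boundaries: along the boundary of square \<open>j\<close> it depends
  on the position in that square only, and transversally it does not depend on it.\<close>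

definition bdry :: "nat \<Rightarrow> nat \<Rightarrow> (nat \<Rightarrow> nat) \<Rightarrow> bool" where
  "bdry m j x \<longleftrightarrow> x (2*j) \<in> {0,m} \<or> x (Suc (2*j)) \<in> {0,m}"

definition partner :: "nat \<Rightarrow> nat" where
  "partner k = (if even k then Suc k else k - 1)"

definition adapted :: "nat \<Rightarrow> nat \<Rightarrow> (nat \<Rightarrow> (nat \<Rightarrow> nat) \<Rightarrow> real) \<Rightarrow> bool" where
  "adapted N m a \<longleftrightarrow>
     (\<forall>k x y. k div 2 < N \<longrightarrow> x (partner k) \<in> {0,m} \<longrightarrow> x k = y k \<longrightarrow> x (partner k) = y (partner k) \<longrightarrow>
        a k x = a k y) \<and>
     (\<forall>j l x y. j < N \<longrightarrow> l div 2 < N \<longrightarrow> l div 2 \<noteq> j \<longrightarrow> bdry m j x \<longrightarrow> bdry m j y \<longrightarrow>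
        (\<forall>k. k div 2 \<noteq> j \<longrightarrow> x k = y k) \<longrightarrow> a l x = a l y)"

lemma adapted_edge:
  "\<lbrakk>adapted N m a; k div 2 < N; x (partner k) \<in> {0,m}; x k = y k; x (partner k) = y (partner k)\<rbrakk>
    \<Longrightarrow> a k x = a k y"
  unfolding adapted_def by blast

lemma adapted_transverse:
  "\<lbrakk>adapted N m a; j < N; l div 2 < N; l div 2 \<noteq> j; bdry m j x; bdry m j y;
     \<forall>k. k div 2 \<noteq> j \<longrightarrow> x k = y k\<rbrakk> \<Longrightarrow> a l x = a l y"
  unfolding adapted_def by blast

lemma partner_simps [simp]: "partner (2*j) = Suc (2*j)" "partner (Suc (2*j)) = 2*j"
  by (auto simp: partner_def)

lemma partner_div [simp]: "partner k div 2 = k div 2"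
  by (cases "even k") (auto simp: partner_def elim!: oddE)

lemma partner_neq [simp]: "partner k \<noteq> k" "k \<noteq> partner k"
  by (auto simp: partner_def elim!: oddE)

lemma div2_eq_iff: "l div 2 = k div 2 \<longleftrightarrow> l = k \<or> l = partner k" for k l :: nat
  by (cases "even k"; cases "even l") (auto simp: partner_def elim!: evenE oddE)

lemma partner_partner [simp]: "partner (partner k) = k"
  by (auto simp: partner_def elim!: oddE)

lemma bdry_iff: "bdry m (k div 2) x \<longleftrightarrow> x k \<in> {0,m} \<or> x (partner k) \<in> {0,m}"
  by (cases "even k") (auto simp: partner_def bdry_def elim!: oddE evenE)

text \<open>On a side running in direction \<open>k\<close>, the first clause of
  \<open>adapted\<close> identifies the two \<open>k\<close>-edges of the elementary square, and the
  second clause the two \<open>q\<close>-edges.\<close>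

lemma curv_boundary_zero:
  assumes a: "adapted N m a" and k: "k div 2 < N" and q: "q div 2 < N" "q \<noteq> k" "q \<noteq> partner k"
    and x: "x (partner k) \<in> {0,m}"
  shows "curv a k q x = 0" "curv a q k x = 0"
proof -
  have qd: "q div 2 \<noteq> k div 2" using q by (simp add: div2_eq_iff)
  have p: "partner k \<noteq> q" "q \<noteq> k" using q by auto
  have 1: "a k (bump q x) = a k x"
    by (rule adapted_edge[OF a k]) (use x p in \<open>auto simp: bump_def\<close>)
  have "bdry m (k div 2) x" "bdry m (k div 2) (bump k x)"
    using x by (auto simp: bdry_iff bump_def)
  moreover have "\<forall>l. l div 2 \<noteq> k div 2 \<longrightarrow> bump k x l = x l" by (auto simp: bump_def)
  ultimately have 2: "a q (bump k x) = a q x"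
    by (intro adapted_transverse[OF a k q(1) qd])
  show "curv a k q x = 0" "curv a q k x = 0" using 1 2 by (simp_all add: curv_def)
qed

text \<open>As \<open>partner k\<close> is missing from \<open>K\<close>, each term either pairs
  \<open>k\<close> with a direction of another square, where the curvature vanishes, or keeps
  \<open>k\<close> for the induction hypothesis.\<close>

lemma chern_boundary_zero:
  assumes "finite K" "\<forall>a\<in>set as. adapted N m a" "\<forall>k\<in>K. k div 2 < N"
    "k \<in> K" "partner k \<notin> K" "x (partner k) \<in> {0,m}"
  shows "chern as K x = 0"
  using assms
proof (induction as arbitrary: K x)
  case (Cons b as)
  have "curv b p q x * chern as (K - {p} - {q}) (bump q (bump p x)) = 0"
    if pq: "p \<in> K" "q \<in> K - {p}" for p q
  proof (cases "k \<in> {p, q}")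
    case True
    have "adapted N m b" using Cons.prems by simp
    then have "curv b p q x = 0"
      using True curv_boundary_zero[of N m b k _ x] pq Cons.prems by auto
    then show ?thesis by simp
  next
    case False
    have "partner k \<noteq> p" "partner k \<noteq> q" using pq Cons.prems by auto
    then have "chern as (K - {p} - {q}) (bump q (bump p x)) = 0"
      using Cons.prems False by (intro Cons.IH) (auto simp: bump_def)
    then show ?thesis by simp
  qed
  then have "2 * chern (b # as) K x = 0"
    unfolding chern_Cons_curv[OF Cons.prems(1)] by (intro sum.neutral ballI) simp
  then show ?case by simp
qed auto

text \<open>For forms without directions in square \<open>j\<close> its collapsed boundary is a
  single point: steps in other directions stay on it, and the cochains do not see the position
  there.\<close>

lemma chern_boundary_invariant:
  assumes "finite K" "\<forall>a\<in>set as. adapted N m a" "\<forall>k\<in>K. k div 2 < N \<and> k div 2 \<noteq> j" "j < N"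
    "bdry m j x" "bdry m j y" "\<forall>k. k div 2 \<noteq> j \<longrightarrow> x k = y k"
  shows "chern as K x = chern as K y"
  using assms
proof (induction as arbitrary: K x y)
  case (Cons b as)
  have bumps: "bdry m j (bump k x) \<and> bdry m j (bump k y) \<and>
     (\<forall>l. l div 2 \<noteq> j \<longrightarrow> bump k x l = bump k y l)"
    if "k \<in> K" "bdry m j x" "bdry m j y" "\<forall>k. k div 2 \<noteq> j \<longrightarrow> x k = y k" for k x y
  proof -
    have "k \<noteq> 2*j" "k \<noteq> Suc (2*j)" "k div 2 \<noteq> j" using that Cons.prems by auto
    then show ?thesis using that by (auto simp: bdry_def bump_def)
  qed
  have inv: "b k x = b k y" if "k \<in> K" "bdry m j x" "bdry m j y" "\<forall>k. k div 2 \<noteq> j \<longrightarrow> x k = y k"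
    for k x y
    by (rule adapted_transverse[of N m b j]) (use Cons.prems that in auto)
  have "curv b p q x * chern as (K - {p} - {q}) (bump q (bump p x)) =
        curv b p q y * chern as (K - {p} - {q}) (bump q (bump p y))"
    if pq: "p \<in> K" "q \<in> K - {p}" for p q
  proof -
    note h = Cons.prems(5,6,7)
    have q: "q \<in> K" using pq by simp
    note hp = bumps[OF pq(1) h] and hq = bumps[OF q h]
    have "curv b p q x = curv b p q y"
      unfolding curv_def using inv[OF pq(1) h] inv[OF q h]
        inv[of q "bump p x" "bump p y"] inv[of p "bump q x" "bump q y"] hp hq pq(1) q by simp
    moreover have "chern as (K - {p} - {q}) (bump q (bump p x)) = chern as (K - {p} - {q}) (bump q (bump p y))"
      using bumps[OF q, of "bump p x" "bump p y"] hp Cons.prems(1-4)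
      by (intro Cons.IH) auto
    ultimately show ?thesis by simp
  qed
  then have "2 * chern (b # as) K x = 2 * chern (b # as) K y"
    unfolding chern_Cons_curv[OF Cons.prems(1)] by (intro sum.cong refl) simp
  then show ?case by simp
qed auto

section \<open>Summation over the grid\<close>

definition gridbox :: "nat \<Rightarrow> nat set \<Rightarrow> (nat \<Rightarrow> nat) set" where
  "gridbox m K = {x. \<forall>k. if k \<in> K then x k < m else x k = 0}"

definition pairs :: "nat set \<Rightarrow> nat set" where
  "pairs J = {k. k div 2 \<in> J}"

text \<open>The counterclockwise line integral of \<open>a\<close> around square \<open>j\<close>,
  with all other coordinates 0.\<close>

definition winding :: "nat \<Rightarrow> (nat \<Rightarrow> (nat \<Rightarrow> nat) \<Rightarrow> real) \<Rightarrow> nat \<Rightarrow> real" where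
  "winding m a j =
     (\<Sum>t<m. a (Suc (2*j)) ((\<lambda>_. 0)(2*j := m, Suc (2*j) := t)) - a (Suc (2*j)) ((\<lambda>_. 0)(2*j := 0, Suc (2*j) := t)))
   - (\<Sum>t<m. a (2*j) ((\<lambda>_. 0)(Suc (2*j) := m, 2*j := t)) - a (2*j) ((\<lambda>_. 0)(Suc (2*j) := 0, 2*j := t)))"

text \<open>Expansion along the first row; the value is 0 unless there are as many rows as elements
  of \<open>J\<close>.\<close>

fun permanent :: "(nat \<Rightarrow> 'a::comm_ring_1) list \<Rightarrow> nat set \<Rightarrow> 'a" where
  "permanent [] J = (if J = {} then 1 else 0)"
| "permanent (r # rs) J = (\<Sum>j\<in>J. r j * permanent rs (J - {j}))"

lemma sum_box_insert:
  fixes f :: "(nat \<Rightarrow> nat) \<Rightarrow> real"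
  assumes "k \<notin> K"
  shows "(\<Sum>x\<in>gridbox m (insert k K). f x) = (\<Sum>x\<in>gridbox m K. \<Sum>t<m. f (x(k := t)))"
  unfolding sum.cartesian_product
  by (rule sum.reindex_bij_witness[where i = "\<lambda>(x, t). x(k := t)" and j = "\<lambda>x. (x(k := 0), x k)"])
    (use assms in \<open>auto simp: gridbox_def fun_upd_idem_iff split: if_splits\<close>)

lemma sum_box_telescope:
  fixes f :: "(nat \<Rightarrow> nat) \<Rightarrow> real"
  assumes "k \<in> K"
  shows "(\<Sum>x\<in>gridbox m K. f (bump k x) - f x) =
         (\<Sum>x\<in>gridbox m (K - {k}). f (x(k := m))) - (\<Sum>x\<in>gridbox m (K - {k}). f (x(k := 0)))"
proof -
  have "(\<Sum>x\<in>gridbox m (insert k (K - {k})). f (bump k x) - f x) =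
    (\<Sum>x\<in>gridbox m (K - {k}). \<Sum>t<m. f (x(k := Suc t)) - f (x(k := t)))"
    by (subst sum_box_insert) (auto simp: bump_def)
  also have "\<dots> = (\<Sum>x\<in>gridbox m (K - {k}). f (x(k := m)) - f (x(k := 0)))"
    by (intro sum.cong refl) (rule sum_lessThan_telescope)
  finally show ?thesis using assms by (simp add: insert_absorb sum_subtractf)
qed

lemma pairs_insert: "pairs (insert j J) = insert (2*j) (insert (Suc (2*j)) (pairs J))"
  by (auto simp: pairs_def)

lemma pairs_empty [simp]: "pairs {} = {}"
  by (simp add: pairs_def)

lemma finite_pairs [simp]: "finite J \<Longrightarrow> finite (pairs J)"
  by (induction J rule: finite_induct) (auto simp: pairs_insert)

lemma sum_pairs:
  fixes f :: "nat \<Rightarrow> 'a::comm_monoid_add"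
  assumes "finite J" shows "sum f (pairs J) = (\<Sum>j\<in>J. f (2*j) + f (Suc (2*j)))"
  using assms
proof (induction J rule: finite_induct)
  case (insert j J)
  have "2*j \<notin> insert (Suc (2*j)) (pairs J)" "Suc (2*j) \<notin> pairs J"
    using insert by (auto simp: pairs_def)
  then show ?case using insert by (simp add: pairs_insert add.assoc)
qed simp

lemma card_pairs: "finite J \<Longrightarrow> card (pairs J) = 2 * card J"
  using sum_pairs[of J "\<lambda>_. 1::nat"] by simp

text \<open>The directions of earlier squares come in twos and cause no sign. For this reason the
  total over the grid is a permanent and not a determinant.\<close>

lemma esign_pairs:
  assumes "finite J" "j \<in> J"
  shows "esign (2*j) (pairs J) = 1" "esign (Suc (2*j)) (pairs J) = -1"
    "esign (Suc (2*j)) (pairs J - {2*j}) = 1" "esign (2*j) (pairs J - {Suc (2*j)}) = 1"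
proof -
  let ?P = "pairs (J \<inter> {..<j})"
  have fin: "finite (J \<inter> {..<j})" using assms by simp
  have "{l \<in> pairs J. l < 2*j} = ?P" "{l \<in> pairs J - {2*j}. l < Suc (2*j)} = ?P"
    "{l \<in> pairs J - {Suc (2*j)}. l < 2*j} = ?P"
    using assms by (auto simp: pairs_def)
  moreover have "{l \<in> pairs J. l < Suc (2*j)} = insert (2*j) ?P"
    using assms by (auto simp: pairs_def)
  moreover have "2*j \<notin> ?P" by (auto simp: pairs_def)
  ultimately show "esign (2*j) (pairs J) = 1" "esign (Suc (2*j)) (pairs J) = -1"
    "esign (Suc (2*j)) (pairs J - {2*j}) = 1" "esign (2*j) (pairs J - {Suc (2*j)}) = 1"
    using fin by (auto simp: esign_def card_pairs)
qed

lemma esign_partner: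
  assumes "finite J" "k \<in> pairs J" shows "esign (partner k) (pairs J - {k}) = 1"
proof (cases "even k")
  case True
  then obtain j where "k = 2*j" by (auto elim: evenE)
  then show ?thesis using assms esign_pairs(3)[of J j] by (auto simp: pairs_def)
next
  case False
  then obtain j where "k = Suc (2*j)" by (auto elim: oddE)
  then show ?thesis using assms esign_pairs(4)[of J j] by (auto simp: pairs_def)
qed

text \<open>Only the edge in direction \<open>partner k\<close> contributes: removing any other
  \<open>l\<close> leaves \<open>partner k\<close> without its partner. The remaining factor is
  constant on the collapsed boundary and is moved to the corner 0.\<close>

lemma wdg_boundary:
  assumes J: "finite J" "J \<subseteq> {..<N}" and k: "k \<in> pairs J"
    and ad: "adapted N m a" "\<forall>b\<in>set as. adapted N m b"
    and c: "c \<in> {0,m}"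
  shows "wdg a (chern as) (pairs J - {k}) (x(k := c)) =
     a (partner k) ((\<lambda>_. 0)(k := c, partner k := x (partner k))) *
     chern as (pairs (J - {k div 2})) (x(k := 0, partner k := 0))"
proof -
  let ?K = "pairs J" and ?k' = "partner k" and ?y = "x(k := c)"
  have lt: "l div 2 < N" if "l \<in> ?K" for l using that J by (auto simp: pairs_def)
  have k': "?k' \<in> ?K" using k by (simp add: pairs_def)
  have K2: "?K - {k} - {?k'} = pairs (J - {k div 2})"
    using div2_eq_iff[of _ k] by (auto simp: pairs_def)
  have "chern as (?K - {k} - {l}) (bump l ?y) = 0" if l: "l \<in> ?K - {k} - {?k'}" for l
  proof (rule chern_boundary_zero[where k = ?k' and N = N and m = m])
    show "finite (?K - {k} - {l})" using J by simp
    show "?k' \<in> ?K - {k} - {l}" using k' l by auto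
    show "bump l ?y (partner ?k') \<in> {0,m}" using l c by (auto simp: bump_def)
  qed (use ad lt in auto)
  then have "wdg a (chern as) (?K - {k}) ?y =
    (\<Sum>l\<in>{?k'}. esign l (?K - {k}) * (a l ?y * chern as (?K - {k} - {l}) (bump l ?y)))"
    unfolding wdg_def using J k' by (intro sum.mono_neutral_right) auto
  also have "\<dots> = a ?k' ?y * chern as (pairs (J - {k div 2})) (bump ?k' ?y)"
    using esign_partner[OF J(1) k] by (simp add: K2)
  also have "chern as (pairs (J - {k div 2})) (bump ?k' ?y) =
      chern as (pairs (J - {k div 2})) (x(k := 0, ?k' := 0))"
  proof (rule chern_boundary_invariant[where j = "k div 2" and N = N and m = m])
    show "\<forall>l. l div 2 \<noteq> k div 2 \<longrightarrow> bump ?k' ?y l = (x(k := 0, ?k' := 0)) l"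
      by (auto simp: bump_def)
    show "k div 2 < N" using lt k by simp
    show "finite (pairs (J - {k div 2}))" using J by simp
  qed (use J ad c in \<open>auto simp: pairs_def bdry_iff bump_def\<close>)
  also have "a ?k' ?y = a ?k' ((\<lambda>_. 0)(k := c, ?k' := x ?k'))"
    by (rule adapted_edge[OF ad(1)]) (use lt k c in auto)
  finally show ?thesis .
qed

lemma sum_wdg_boundary:
  assumes J: "finite J" "J \<subseteq> {..<N}" and k: "k \<in> pairs J"
    and ad: "adapted N m a" "\<forall>b\<in>set as. adapted N m b"
    and c: "c \<in> {0,m}"
  shows "(\<Sum>x\<in>gridbox m (pairs J - {k}). wdg a (chern as) (pairs J - {k}) (x(k := c))) =
     (\<Sum>t<m. a (partner k) ((\<lambda>_. 0)(k := c, partner k := t))) *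
     (\<Sum>x\<in>gridbox m (pairs (J - {k div 2})). chern as (pairs (J - {k div 2})) x)"
proof -
  let ?J' = "pairs (J - {k div 2})"
  have notin: "partner k \<notin> ?J'" "k \<notin> ?J'" by (auto simp: pairs_def)
  have ins: "pairs J - {k} = insert (partner k) ?J'"
    using k div2_eq_iff[of _ k] by (auto simp: pairs_def)
  have z: "x(partner k := t, k := 0, partner k := 0) = x" if "x \<in> gridbox m ?J'" for x :: "nat \<Rightarrow> nat" and t
    using that notin by (auto simp: gridbox_def fun_eq_iff)
  have "(\<Sum>x\<in>gridbox m (pairs J - {k}). wdg a (chern as) (pairs J - {k}) (x(k := c))) =
    (\<Sum>x\<in>gridbox m (pairs J - {k}). a (partner k) ((\<lambda>_. 0)(k := c, partner k := x (partner k))) *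
     chern as ?J' (x(k := 0, partner k := 0)))"
    by (intro sum.cong refl wdg_boundary[OF assms])
  also have "\<dots> = (\<Sum>x\<in>gridbox m ?J'. \<Sum>t<m. a (partner k) ((\<lambda>_. 0)(k := c, partner k := t)) *
     chern as ?J' x)"
    unfolding ins sum_box_insert[OF notin(1)]
    by (intro sum.cong refl) (simp add: z del: fun_upd_upd)
  finally show ?thesis by (simp add: sum_distrib_right sum_distrib_left sum.swap[of _ "gridbox m ?J'"])
qed

text \<open>Discrete Stokes: the outer \<open>dif\<close> telescopes to sums over sides. The four
  sides of square \<open>j\<close> combine to the winding around it times the total over the other
  squares, which is the row expansion of the permanent.\<close>

lemma chern_total:
  assumes "finite J" "J \<subseteq> {..<N}" "\<forall>a\<in>set as. adapted N m a"
  shows "(\<Sum>x\<in>gridbox m (pairs J). chern as (pairs J) x) = permanent (map (winding m) as) J"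
  using assms
proof (induction as arbitrary: J)
  case Nil
  have "pairs J = {} \<longleftrightarrow> J = {}"
    by (auto simp: pairs_def) (metis nonzero_mult_div_cancel_left zero_neq_numeral)
  moreover have "gridbox m {} = {\<lambda>_. 0}" by (auto simp: gridbox_def)
  ultimately show ?case by auto
next
  case (Cons a as)
  let ?K = "pairs J"
  define \<xi> where "\<xi> = wdg a (chern as)"
  define I where "I j = (\<Sum>x\<in>gridbox m (pairs (J - {j})). chern as (pairs (J - {j})) x)" for j
  define f where "f k c = (\<Sum>t<m. a (partner k) ((\<lambda>_. 0)(k := c, partner k := t)))" for k c
  have ad: "adapted N m a" "\<forall>b\<in>set as. adapted N m b" using Cons.prems by auto
  have IH: "I j = permanent (map (winding m) as) (J - {j})" for j
    unfolding I_def by (rule Cons.IH) (use Cons.prems in auto)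
  have B: "(\<Sum>x\<in>gridbox m (?K - {k}). \<xi> (?K - {k}) (x(k := c))) = f k c * I (k div 2)"
    if "k \<in> ?K" "c \<in> {0,m}" for k c
    unfolding \<xi>_def f_def I_def using sum_wdg_boundary[OF Cons.prems(1,2) that(1) ad that(2)] .
  have wind: "winding m a j = f (2*j) m - f (2*j) 0 - (f (Suc (2*j)) m - f (Suc (2*j)) 0)" for j
    by (simp add: winding_def f_def sum_subtractf)
  have "(\<Sum>x\<in>gridbox m ?K. chern (a # as) ?K x) =
     (\<Sum>k\<in>?K. \<Sum>x\<in>gridbox m ?K. esign k ?K * (\<xi> (?K - {k}) (bump k x) - \<xi> (?K - {k}) x))"
    by (simp add: dif_def \<xi>_def sum.swap[of _ "gridbox m ?K"])
  also have "\<dots> = (\<Sum>k\<in>?K. esign k ?K * ((f k m - f k 0) * I (k div 2)))"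
    by (intro sum.cong refl) (simp add: sum_distrib_left[symmetric] sum_box_telescope B left_diff_distrib)
  also have "\<dots> = (\<Sum>j\<in>J. winding m a j * I j)"
    unfolding sum_pairs[OF Cons.prems(1)]
    using Cons.prems(1) wind
    by (intro sum.cong refl) (simp add: esign_pairs left_diff_distrib)
  finally show ?case by (simp add: IH)
qed

section \<open>Common zeros of equivariant systems\<close>

lemma Arg_mult_Re_pos:
  assumes "0 < Re u" "0 < Re v" shows "Arg (u * v) = Arg u + Arg v"
proof -
  have nz: "u \<noteq> 0" "v \<noteq> 0" using assms by auto
  have "\<bar>Arg u\<bar> < pi/2" "\<bar>Arg v\<bar> < pi/2"
    using assms nz Re_Ln_pos_lt[of u] Re_Ln_pos_lt[of v] by (simp_all add: Arg_eq_Im_Ln)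
  then show ?thesis using nz by (intro Arg_times) auto
qed

lemma Arg_divide_Re_pos:
  assumes "0 < Re u" "0 < Re v" shows "Arg (v / u) = Arg v - Arg u"
proof -
  have "0 < Re (inverse u)" using assms by (auto simp: add_pos_nonneg)
  moreover have "Arg (inverse u) = - Arg u"
    using assms by (subst Arg_inverse) (auto simp: complex_is_Real_iff Arg_eq_0)
  ultimately show ?thesis using assms Arg_mult_Re_pos[of v "inverse u"] by (simp add: divide_inverse)
qed

lemma Arg_cnj_Re_pos: "0 < Re u \<Longrightarrow> Arg (cnj u) = - Arg u"
  by (auto simp: Arg_cnj complex_is_Real_iff Arg_eq_0)

lemma Re_pos_of_near_one: "norm (z - 1) < 1 \<Longrightarrow> 0 < Re z"
  using abs_Re_le_cmod[of "z - 1"] by simp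

text \<open>Lattice coordinates 0 and \<open>m\<close> go to -1 and 1, so the boundary of each
  square winds once around 0.\<close>

definition gridpoint :: "nat \<Rightarrow> (nat \<Rightarrow> nat) \<Rightarrow> nat \<Rightarrow> complex" where
  "gridpoint m x j = Complex (2 * real (x (2*j)) / real m - 1) (2 * real (x (Suc (2*j))) / real m - 1)"

definition twist :: "bool \<Rightarrow> complex \<Rightarrow> complex" where
  "twist c z = (if c then cnj z else z)"

text \<open>On boundary edges the twist is used because the quotient of values of \<open>F\<close> is lost where \<open>F\<close>
  vanishes.\<close>

definition angle_form ::
  "nat \<Rightarrow> (nat \<Rightarrow> bool) \<Rightarrow> ((nat \<Rightarrow> complex) \<Rightarrow> complex) \<Rightarrow> nat \<Rightarrow> (nat \<Rightarrow> nat) \<Rightarrow> real" where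
  "angle_form m c F k x =
     (if x (partner k) \<in> {0,m}
      then Arg (twist (c (k div 2)) (gridpoint m (bump k x) (k div 2)) /
                twist (c (k div 2)) (gridpoint m x (k div 2)))
      else Arg (F (gridpoint m (bump k x)) / F (gridpoint m x)))"

text \<open>The change of argument along the right side of the square, from 1 - i to 1 + i.\<close>

definition side_angle :: real where
  "side_angle = 2 * Arg (Complex 1 1)"

lemma side_angle_neq_0: "side_angle \<noteq> 0"
  by (simp add: side_angle_def Arg_eq_0 complex_is_Real_iff)

lemma sum_Arg_side:
  assumes "m > 0"
  shows "(\<Sum>t<m. Arg (Complex 1 (2 * real (Suc t) / m - 1) / Complex 1 (2 * real t / m - 1))) = side_angle"
proof -
  have "(\<Sum>t<m. Arg (Complex 1 (2 * real (Suc t) / m - 1) / Complex 1 (2 * real t / m - 1))) =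
    (\<Sum>t<m. Arg (Complex 1 (2 * real (Suc t) / m - 1)) - Arg (Complex 1 (2 * real t / m - 1)))"
    by (intro sum.cong refl Arg_divide_Re_pos) auto
  also have "\<dots> = Arg (Complex 1 1) - Arg (Complex 1 (-1))"
    using assms by (subst sum_lessThan_telescope) auto
  also have "Complex 1 (-1) = cnj (Complex 1 1)" by (simp add: complex_eq_iff)
  finally show ?thesis by (simp add: Arg_cnj_Re_pos side_angle_def del: complex_cnj)
qed

lemma Arg_cnj_divide:
  assumes "0 < Re u" "0 < Re v" shows "Arg (cnj v / cnj u) = - Arg (v / u)"
  using assms by (simp add: Arg_divide_Re_pos Arg_cnj_Re_pos)

text \<open>Each side is the right side rotated by a power of i, and common factors cancel in
  quotients. So every side contributes the same angle, and conjugation reverses its sign.\<close>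

lemma winding_angle_form:
  assumes "m > 0"
  shows "winding m (angle_form m c F) j = (if c j then - 1 else 1) * (4 * side_angle)"
proof -
  define y where "y t = 2 * real t / m - 1" for t :: nat
  define s where "s = (if c j then - 1 else 1 :: real)"
  have y0: "y 0 = -1" "y m = 1" using assms by (auto simp: y_def)
  have gp: "gridpoint m x j = Complex (y (x (2*j))) (y (x (Suc (2*j))))" for x
    by (simp add: gridpoint_def y_def)
  let ?q = "\<lambda>t. Complex 1 (y (Suc t)) / Complex 1 (y t)"
  have q: "Arg (cnj (Complex 1 (y (Suc t))) / cnj (Complex 1 (y t))) = - Arg (?q t)" for t
    by (rule Arg_cnj_divide) auto
  have twist: "Arg (twist (c j) (w * Complex 1 (y (Suc t))) / twist (c j) (w * Complex 1 (y t))) = s * Arg (?q t)"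
    "Arg (twist (c j) (w * cnj (Complex 1 (y (Suc t)))) / twist (c j) (w * cnj (Complex 1 (y t)))) = - s * Arg (?q t)"
    if "w \<noteq> 0" for w t
    using q[of t] that by (auto simp: twist_def s_def)
  have r: "angle_form m c F (Suc (2*j)) ((\<lambda>_. 0)(2*j := m, Suc (2*j) := t)) = s * Arg (?q t)" for t
    using twist(1)[of 1 t] by (simp add: angle_form_def gp bump_def y0)
  \<comment> \<open>Increasing coordinates run through the left and top sides clockwise, hence the
    conjugates.\<close>
  have "\<i> * cnj (Complex 1 b) = Complex b 1" "- \<i> * Complex 1 b = Complex b (-1)"
    "(- 1) * cnj (Complex 1 b) = Complex (-1) b" for b
    by (auto simp: complex_eq_iff)
  note ieq = this
  have l: "angle_form m c F (Suc (2*j)) ((\<lambda>_. 0)(2*j := 0, Suc (2*j) := t)) = - s * Arg (?q t)" for t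
    using twist(2)[of "-1" t] unfolding ieq by (simp add: angle_form_def gp bump_def y0)
  have u: "angle_form m c F (2*j) ((\<lambda>_. 0)(Suc (2*j) := m, 2*j := t)) = - s * Arg (?q t)" for t
    using twist(2)[of "\<i>" t] unfolding ieq by (simp add: angle_form_def gp bump_def y0)
  have d: "angle_form m c F (2*j) ((\<lambda>_. 0)(Suc (2*j) := 0, 2*j := t)) = s * Arg (?q t)" for t
    using twist(1)[of "- \<i>" t] unfolding ieq by (simp add: angle_form_def gp bump_def y0)
  have S: "(\<Sum>t<m. Arg (?q t)) = side_angle"
    using sum_Arg_side[OF assms] by (simp add: y_def)
  show ?thesis
    unfolding winding_def r l u d
    by (simp add: sum_subtractf sum_distrib_left[symmetric] sum_negf S) (simp add: s_def)
qed

text \<open>The point 1 lies on the boundary of the square and serves as its base point. After the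
  collapse, \<open>F e\<close> is a section with transition function \<open>z b\<close> or its
  conjugate.\<close>

locale equivariant_system =
  fixes N :: nat and c :: "nat \<Rightarrow> nat \<Rightarrow> bool" and F :: "nat \<Rightarrow> (nat \<Rightarrow> complex) \<Rightarrow> complex"
  assumes equiv: "\<lbrakk>e < N; b < N; \<bar>Re (z b)\<bar> = 1 \<or> \<bar>Im (z b)\<bar> = 1\<rbrakk>
    \<Longrightarrow> F e z = twist (c e b) (z b) * F e (z(b := 1))"
begin

lemma bdry_gridpoint:
  assumes "m > 0" "bdry m j x" shows "\<bar>Re (gridpoint m x j)\<bar> = 1 \<or> \<bar>Im (gridpoint m x j)\<bar> = 1"
  using assms by (auto simp: bdry_def gridpoint_def)

lemma gridpoint_cong:
  "(\<And>k. k div 2 = j \<Longrightarrow> x k = y k) \<Longrightarrow> gridpoint m x j = gridpoint m y j"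
  by (simp add: gridpoint_def)

lemma twist_neq_0:
  assumes "m > 0" "bdry m j x" shows "twist b (gridpoint m x j) \<noteq> 0"
  using bdry_gridpoint[OF assms] by (auto simp: twist_def)

text \<open>A step outside square \<open>j\<close> has the same twist factor at both ends; it
  cancels in the quotient and leaves values at the base point 1.\<close>

lemma adapted_angle_form:
  assumes m: "m > 0" and e: "e < N" shows "adapted N m (angle_form m (c e) (F e))"
  unfolding adapted_def
proof (intro conjI allI impI)
  fix k x y
  assume h: "k div 2 < N" "x (partner k) \<in> {0,m}" "x k = y k" "x (partner k) = (y (partner k) :: nat)"
  have "gridpoint m x (k div 2) = gridpoint m y (k div 2)"
    "gridpoint m (bump k x) (k div 2) = gridpoint m (bump k y) (k div 2)"
    by (rule gridpoint_cong; use h in \<open>auto simp: div2_eq_iff bump_def\<close>)+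
  then show "angle_form m (c e) (F e) k x = angle_form m (c e) (F e) k y"
    using h by (simp add: angle_form_def)
next
  fix j l x y
  assume h: "j < N" "l div 2 < N" "l div 2 \<noteq> j" "bdry m j x" "bdry m j y"
    "\<forall>k. k div 2 \<noteq> j \<longrightarrow> x k = (y k :: nat)"
  have "(partner l) div 2 \<noteq> j" using h by simp
  then have xy: "x (partner l) = y (partner l)" "x l = y l" using h by blast+
  have gl: "gridpoint m x (l div 2) = gridpoint m y (l div 2)"
    "gridpoint m (bump l x) (l div 2) = gridpoint m (bump l y) (l div 2)"
    by (rule gridpoint_cong; use h in \<open>auto simp: bump_def\<close>)+
  have other: "(gridpoint m x)(j := 1) = (gridpoint m y)(j := 1)"
      "(gridpoint m (bump l x))(j := 1) = (gridpoint m (bump l y))(j := 1)"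
    using h by (auto simp: fun_eq_iff bump_def intro!: gridpoint_cong)
  have ratio: "F e (gridpoint m (bump l z)) / F e (gridpoint m z) =
     F e ((gridpoint m (bump l z))(j := 1)) / F e ((gridpoint m z)(j := 1))" if z: "bdry m j z" for z
  proof -
    have "gridpoint m (bump l z) j = gridpoint m z j"
      by (rule gridpoint_cong) (use h in \<open>auto simp: bump_def\<close>)
    then show ?thesis
      using equiv[of e j "gridpoint m z"] equiv[of e j "gridpoint m (bump l z)"]
        bdry_gridpoint[OF m z] twist_neq_0[OF m z] e h(1) by simp
  qed
  show "angle_form m (c e) (F e) l x = angle_form m (c e) (F e) l y"
    unfolding angle_form_def ratio[OF h(4)] ratio[OF h(5)] gl xy other ..
qed

text \<open>On a boundary edge both values of \<open>F e\<close> share the value at the base point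
  as a factor. It is nonzero here and cancels, so the two branches of \<open>angle_form\<close>
  agree.\<close>

lemma angle_form_eq_Arg:
  assumes m: "m > 0" and e: "e < N" and k: "k div 2 < N" and nz: "F e (gridpoint m x) \<noteq> 0"
  shows "angle_form m (c e) (F e) k x = Arg (F e (gridpoint m (bump k x)) / F e (gridpoint m x))"
proof (cases "x (partner k) \<in> {0,m}")
  case True
  let ?j = "k div 2"
  have b: "bdry m ?j x" "bdry m ?j (bump k x)" using True by (auto simp: bdry_iff bump_def)
  have upd: "(gridpoint m (bump k x))(?j := 1) = (gridpoint m x)(?j := 1)"
    by (auto simp: fun_eq_iff bump_def intro!: gridpoint_cong)
  have "F e (gridpoint m (bump k x)) / F e (gridpoint m x) =
     twist (c e ?j) (gridpoint m (bump k x) ?j) / twist (c e ?j) (gridpoint m x ?j)"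
    using equiv[of e ?j "gridpoint m x"] equiv[of e ?j "gridpoint m (bump k x)"]
      bdry_gridpoint[OF m b(1)] bdry_gridpoint[OF m b(2)] e k nz
    unfolding upd by simp
  then show ?thesis using True by (simp add: angle_form_def)
qed (simp add: angle_form_def)

text \<open>With all quotients in the right half-plane, arguments add without jumps along both paths
  from \<open>x\<close> to the opposite corner.\<close>

lemma curv_angle_form_zero:
  assumes m: "m > 0" and e: "e < N" and kl: "k div 2 < N" "l div 2 < N"
    and near: "\<And>y y'. \<lbrakk>y \<in> {x, bump k x, bump l x, bump l (bump k x)};
        y' \<in> {x, bump k x, bump l x, bump l (bump k x)}\<rbrakk>
        \<Longrightarrow> F e (gridpoint m y) \<noteq> 0 \<and> 0 < Re (F e (gridpoint m y') / F e (gridpoint m y))"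
  shows "curv (angle_form m (c e) (F e)) k l x = 0"
proof -
  let ?f = "\<lambda>y. F e (gridpoint m y)"
  have path: "Arg (?f (bump l (bump k x)) / ?f y) + Arg (?f y / ?f x) = Arg (?f (bump l (bump k x)) / ?f x)"
    if "y \<in> {bump k x, bump l x}" for y
  proof -
    have "Arg (?f (bump l (bump k x)) / ?f y * (?f y / ?f x)) =
        Arg (?f (bump l (bump k x)) / ?f y) + Arg (?f y / ?f x)"
      by (rule Arg_mult_Re_pos) (use near that in blast)+
    moreover have "?f y \<noteq> 0" using near that by blast
    ultimately show ?thesis by simp
  qed
  have nz: "?f x \<noteq> 0" "?f (bump k x) \<noteq> 0" "?f (bump l x) \<noteq> 0"
    using near by blast+
  show ?thesis
    unfolding curv_def using nz kl path[of "bump k x"] path[of "bump l x"]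
    by (simp add: angle_form_eq_Arg[OF m e] bump_commute[of k l])
qed


end

section \<open>Metric and compactness of the infinite product of squares\<close>

lemma dist_seq_le:
  fixes x y :: "nat \<Rightarrow> complex"
  assumes "\<And>j. dist (x j) (y j) \<le> e"
  shows "dist x y \<le> 2 * e"
proof -
  \<comment> \<open>The metric on sequences has weights 2^-n, whose sum is 2.\<close>
  have "dist x y \<le> suminf (\<lambda>n. (1/2)^n * e)"
    unfolding dist_fun_def
  proof (rule suminf_le)
    show "(1/2)^n * min (dist (x (from_nat n)) (y (from_nat n))) 1 \<le> (1/2)^n * e" for n
      using assms[of "from_nat n"] by (intro mult_left_mono) auto
    show "summable (\<lambda>n. (1/2)^n * min (dist (x (from_nat n)) (y (from_nat n))) 1 :: real)"
      by (rule summable_comparison_test'[of "\<lambda>n. (1/2)^n"]) (auto simp: summable_geometric_iff)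
    show "summable (\<lambda>n. (1/2)^n * e)"
      by (intro summable_mult2) (simp add: summable_geometric_iff)
  qed
  also have "\<dots> = 2 * e"
    using suminf_mult2[of "\<lambda>n. (1/2::real)^n" e] suminf_geometric[of "1/2::real"]
    by (simp add: summable_geometric_iff)
  finally show ?thesis .
qed

lemma compact_seq_box:
  "compact {z :: nat \<Rightarrow> complex. \<forall>j. \<bar>Re (z j)\<bar> \<le> 1 \<and> \<bar>Im (z j)\<bar> \<le> 1}"
proof -
  let ?Q = "cbox (Complex (-1) (-1)) (Complex 1 1)"
  have "compactin (product_topology (\<lambda>_::nat. euclidean) UNIV) (PiE UNIV (\<lambda>_. ?Q))"
    by (simp add: compactin_PiE)
  moreover have "PiE UNIV (\<lambda>_. ?Q) = {z :: nat \<Rightarrow> complex. \<forall>j. \<bar>Re (z j)\<bar> \<le> 1 \<and> \<bar>Im (z j)\<bar> \<le> 1}"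
    by (auto simp: PiE_def Pi_def in_cbox_complex_iff abs_le_iff)
  ultimately show ?thesis by (simp add: euclidean_product_topology)
qed

lemma permanent_scale:
  "permanent (map (\<lambda>r j. k * r j) rs) J = k ^ length rs * permanent rs J"
  by (induction rs arbitrary: J) (auto simp: sum_distrib_left algebra_simps)

lemma gridpoint_dist:
  assumes "m > 0" "\<And>p. y p = x p \<or> y p = Suc (x p)"
  shows "dist (gridpoint m y j) (gridpoint m x j) \<le> 4 / m"
proof -
  have d: "\<bar>(2 * real (y p) / m - 1) - (2 * real (x p) / m - 1)\<bar> \<le> 2 / m" for p
    using assms(2)[of p] assms(1) by (auto simp: field_simps)
  show ?thesis
    unfolding dist_norm gridpoint_def
    by (rule order_trans[OF cmod_le]) (use d[of "2*j"] d[of "Suc (2*j)"] in simp)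
qed

context equivariant_system
begin

lemma common_zero:
  assumes cont: "\<And>e. e < N \<Longrightarrow> continuous_on UNIV (F e)"
    and perm: "permanent (map (\<lambda>e b. if c e b then - 1 else 1 :: real) [0..<N]) {..<N} \<noteq> 0"
  shows "\<exists>z. \<forall>e<N. F e z = 0"
proof (rule ccontr)
  assume "\<not> ?thesis"
  then have nz: "\<exists>e<N. F e z \<noteq> 0" for z by blast
  then have N: "N > 0" by fastforce
  define Q where "Q = {z :: nat \<Rightarrow> complex. \<forall>j. \<bar>Re (z j)\<bar> \<le> 1 \<and> \<bar>Im (z j)\<bar> \<le> 1}"
  have Q: "compact Q" unfolding Q_def by (rule compact_seq_box)
  have contQ: "continuous_on Q (F e)" if "e < N" for e
    using cont[OF that] continuous_on_subset by blast
  have "continuous_on Q (\<lambda>z. \<Sum>e<N. norm (F e z))"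
    by (intro continuous_on_sum continuous_on_norm contQ) simp
  moreover have "(\<lambda>_. 0) \<in> Q" by (simp add: Q_def)
  ultimately obtain z0 where z0: "z0 \<in> Q"
    "\<And>z. z \<in> Q \<Longrightarrow> (\<Sum>e<N. norm (F e z0)) \<le> (\<Sum>e<N. norm (F e z))"
    using continuous_attains_inf[OF Q] by blast
  \<comment> \<open>The minimum over \<open>Q\<close> is positive. Division by \<open>N\<close>
    gives an equation of modulus at least 4 \<eta> at every point, and the 4 leaves room for the
    deviations below \<eta> within a cube.\<close>
  define \<eta> where "\<eta> = (\<Sum>e<N. norm (F e z0)) / (4 * N)"
  obtain e0 where "e0 < N" "F e0 z0 \<noteq> 0" using nz by blast
  then have "0 < (\<Sum>e<N. norm (F e z0))" by (intro sum_pos2[of _ e0]) auto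
  then have \<eta>: "\<eta> > 0" using N by (simp add: \<eta>_def)
  have large: "\<exists>e<N. 4 * \<eta> \<le> norm (F e z)" if "z \<in> Q" for z
  proof (rule ccontr)
    assume "\<not> ?thesis"
    then have "(\<Sum>e<N. norm (F e z)) < (\<Sum>e<N. 4 * \<eta>)"
      using N by (intro sum_strict_mono) auto
    also have "\<dots> = (\<Sum>e<N. norm (F e z0))" using N by (simp add: \<eta>_def)
    finally show False using z0(2)[OF that] by simp
  qed
  have "\<exists>\<delta>>0. \<forall>z\<in>Q. \<forall>z'\<in>Q. dist z' z < \<delta> \<longrightarrow> dist (F e z') (F e z) < \<eta>" if "e < N" for e
    using compact_uniformly_continuous[OF contQ[OF that] Q] \<eta> unfolding uniformly_continuous_on_def by blast
  then obtain \<delta> where \<delta>: "\<And>e. e < N \<Longrightarrow> \<delta> e > 0"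
    "\<And>e z z'. \<lbrakk>e < N; z \<in> Q; z' \<in> Q; dist z' z < \<delta> e\<rbrakk> \<Longrightarrow> dist (F e z') (F e z) < \<eta>"
    by metis
  define \<Delta> where "\<Delta> = Min (insert 1 (\<delta> ` {..<N}))"
  have \<Delta>: "\<Delta> > 0" "\<And>e. e < N \<Longrightarrow> \<Delta> \<le> \<delta> e" using \<delta>(1) by (auto simp: \<Delta>_def)
  \<comment> \<open>Vertices of a cube differ by at most 4/m in each coordinate, hence by 8/m in the
    sequence metric.\<close>
  obtain m where m: "8 / \<Delta> < real m" using reals_Archimedean2 by blast
  with \<Delta>(1) have m0: "m > 0" by (metis divide_pos_pos of_nat_0_less_iff order_less_trans zero_less_numeral)
  have m8: "8 / real m < \<Delta>" using m m0 \<Delta>(1) by (simp add: field_simps)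
  define a where "a e = angle_form m (c e) (F e)" for e
  let ?K = "pairs {..<N}"
  have "(\<Sum>x\<in>gridbox m ?K. chern (map a [0..<N]) ?K x) = permanent (map (winding m) (map a [0..<N])) {..<N}"
    by (rule chern_total[where N = N]) (auto simp: a_def adapted_angle_form[OF m0])
  also have "map (winding m) (map a [0..<N]) =
      map (\<lambda>r j. (4 * side_angle) * r j) (map (\<lambda>e b. if c e b then - 1 else 1 :: real) [0..<N])"
    by (auto simp: a_def winding_angle_form[OF m0])
  also have "permanent \<dots> {..<N} \<noteq> 0"
    unfolding permanent_scale using perm side_angle_neq_0 by simp
  finally obtain x where x: "x \<in> gridbox m ?K" "chern (map a [0..<N]) ?K x \<noteq> 0"
    by (meson sum.neutral)
  define cube where "cube = {y. \<forall>p. y p = x p \<or> p \<in> ?K \<and> y p = Suc (x p)}"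
  have gpQ: "gridpoint m y \<in> Q" if "y \<in> cube" for y
  proof -
    have "y p \<le> m" for p
    proof -
      have "if p \<in> ?K then x p < m else x p = 0" using x(1) by (simp add: gridbox_def)
      moreover have "y p = x p \<or> p \<in> ?K \<and> y p = Suc (x p)" using that by (simp add: cube_def)
      ultimately show ?thesis by (auto split: if_splits)
    qed
    then show ?thesis using m0 by (auto simp: Q_def gridpoint_def abs_le_iff field_simps)
  qed
  have "x \<in> cube" by (simp add: cube_def)
  then obtain e where e: "e < N" "4 * \<eta> \<le> norm (F e (gridpoint m x))" using large gpQ by blast
  have close: "dist (F e (gridpoint m y)) (F e (gridpoint m x)) < \<eta>" if "y \<in> cube" for y
  proof -
    have "y p = x p \<or> y p = Suc (x p)" for p using that by (auto simp: cube_def)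
    then have "dist (gridpoint m y) (gridpoint m x) \<le> 2 * (4 / m)"
      by (intro dist_seq_le gridpoint_dist[OF m0])
    also have "\<dots> < \<delta> e" using m8 \<Delta>(2)[OF e(1)] by simp
    finally show ?thesis using \<delta>(2) e(1) gpQ \<open>x \<in> cube\<close> that by blast
  qed
  have near: "F e (gridpoint m y) \<noteq> 0 \<and> 0 < Re (F e (gridpoint m y') / F e (gridpoint m y))"
    if "y \<in> cube" "y' \<in> cube" for y y'
  proof -
    let ?u = "F e (gridpoint m y)" and ?v = "F e (gridpoint m y')" and ?w = "F e (gridpoint m x)"
    have "norm ?w \<le> norm ?u + dist ?u ?w" "dist ?v ?u \<le> dist ?v ?w + dist ?u ?w"
      by (metis add.commute dist_commute dist_norm norm_triangle_sub) (rule dist_triangle2)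
    \<comment> \<open>The left side is below 2 \<eta>, the right side above 3 \<eta>.\<close>
    then have *: "norm (?v - ?u) < norm ?u"
      using close[OF that(1)] close[OF that(2)] e(2) \<eta> by (simp add: dist_norm)
    then have u: "?u \<noteq> 0" by auto
    have "?v / ?u - 1 = (?v - ?u) / ?u" using u by (simp add: field_simps)
    then have "norm (?v / ?u - 1) < 1" using * u by (simp add: norm_divide)
    then show ?thesis using u Re_pos_of_near_one by blast
  qed
  have "chern (map a [0..<N]) ?K x = 0"
  proof (rule chern_zero_on_flat_cube)
    show "a e \<in> set (map a [0..<N])" using e by simp
    fix y k l
    assume y: "\<forall>p. y p = x p \<or> p \<in> ?K \<and> y p = Suc (x p)" and kl: "k \<in> ?K" "l \<in> ?K"
      "y k = x k" "y l = x l" "k \<noteq> l"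
    have "{y, bump k y, bump l y, bump l (bump k y)} \<subseteq> cube"
      using y kl by (auto simp: cube_def bump_def)
    then show "curv (a e) k l y = 0"
      unfolding a_def using near kl
      by (intro curv_angle_form_zero[OF m0 e(1)]) (auto simp: pairs_def)
  qed simp
  with x(2) show False by simp
qed

end

section \<open>Orthogonal complements\<close>

interpretation H: vector_space cscale
  by unfold_locales (auto simp: cscale_def fun_eq_iff algebra_simps)

lemma finite_idx [simp]: "finite (idx n d)"
  by (simp add: idx_def finite_PiE)

lemma sum_fun_apply:
  fixes f :: "'a \<Rightarrow> 'b \<Rightarrow> 'c::comm_monoid_add"
  shows "(\<Sum>i\<in>A. f i) x = (\<Sum>i\<in>A. f i x)"
  by (induction A rule: infinite_finite_induct) auto

lemma Hspace_subspace: "H.subspace (Hspace n d)"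
  by (auto simp: H.subspace_def Hspace_def cscale_def)

lemma Hspace_span: "Hspace n d \<subseteq> H.span ((\<lambda>x y. if y = x then 1 else 0) ` idx n d)"
proof
  fix v assume v: "v \<in> Hspace n d"
  let ?u = "\<lambda>x y. if y = x then 1 else 0 :: complex"
  have "v = (\<Sum>x\<in>idx n d. cscale (v x) (?u x))"
  proof
    fix y
    have "(\<Sum>x\<in>idx n d. cscale (v x) (?u x)) y = (\<Sum>x\<in>idx n d. if x = y then v x else 0)"
      by (simp add: cscale_def sum_fun_apply eq_commute if_distrib cong: if_cong)
    then show "v y = (\<Sum>x\<in>idx n d. cscale (v x) (?u x)) y"
      using v by (simp add: Hspace_def)
  qed
  moreover have "(\<Sum>x\<in>idx n d. cscale (v x) (?u x)) \<in> H.span (?u ` idx n d)"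
    by (intro H.span_sum H.span_scale H.span_base) auto
  ultimately show "v \<in> H.span (?u ` idx n d)" by simp
qed

lemma finite_spanning_subset:
  assumes "V \<subseteq> Hspace n d"
  obtains B where "finite B" "B \<subseteq> V" "V \<subseteq> H.span B" "card B = cdim V"
proof -
  obtain B where B: "B \<subseteq> V" "H.independent B" "V \<subseteq> H.span B" "card B = H.dim V"
    using H.basis_exists by blast
  have "finite B"
    using H.independent_span_bound[OF finite_imageI[OF finite_idx] B(2), of _ n d]
      B(1) assms Hspace_span by blast
  with B that show thesis by (simp add: cdim_def)
qed

lemma hinner_linear:
  "hinner n d v (w + w') = hinner n d v w + hinner n d v w'"
  "hinner n d v (w - w') = hinner n d v w - hinner n d v w'"
  "hinner n d v (cscale c w) = c * hinner n d v w"
  "hinner n d (v + v') w = hinner n d v w + hinner n d v' w"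
  "hinner n d (cscale c v) w = cnj c * hinner n d v w"
  by (simp_all add: hinner_def cscale_def sum.distrib sum_subtractf sum_distrib_left algebra_simps)

lemma hinner_0: "hinner n d 0 w = 0"
  by (simp add: hinner_def)

lemma hinner_commute: "hinner n d v w = cnj (hinner n d w v)"
  by (simp add: hinner_def mult.commute)

lemma hinner_self_zero:
  assumes "v \<in> Hspace n d" "hinner n d v v = 0" shows "v = 0"
proof
  fix x
  have "hinner n d v v = of_real (\<Sum>x\<in>idx n d. (norm (v x))\<^sup>2)"
    by (simp add: hinner_def complex_norm_square[unfolded of_real_power] mult.commute)
  then have "(\<Sum>x\<in>idx n d. (norm (v x))\<^sup>2) = 0"
    using assms(2) by (metis of_real_eq_0_iff)
  then have "\<forall>x\<in>idx n d. v x = 0"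
    by (simp add: sum_nonneg_eq_0_iff)
  then show "v x = 0 x" using assms(1) by (auto simp: Hspace_def)
qed

lemma hinner_span_zero:
  assumes "\<And>b. b \<in> B \<Longrightarrow> hinner n d b w = 0" "v \<in> H.span B"
  shows "hinner n d v w = 0"
  using assms(2) 
proof (induction rule: H.span_induct_alt)
  case base
  show ?case by (rule hinner_0)
next
  case (step c x y)
  then show ?case unfolding hinner_linear by (simp add: assms(1))
qed

text \<open>A Gram-Schmidt step: \<open>b'\<close> is the part of \<open>b\<close> orthogonal to the
  span of \<open>B\<close>, so adding a multiple of it to \<open>u\<close> keeps the old
  orthogonality relations.\<close>

lemma orthogonal_projection:
  assumes "finite B"
  shows "\<exists>u\<in>H.span B. \<forall>b\<in>H.span B. hinner n d b (v - u) = 0"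
  using assms
proof (induction B arbitrary: v rule: finite_induct)
  case empty
  have "hinner n d b (v - 0) = 0" if "b \<in> H.span {}" for b
    using that by (simp only: H.span_empty singleton_iff hinner_0)
  then show ?case using H.span_zero by blast
next
  case (insert b B)
  obtain u where u: "u \<in> H.span B" "\<forall>x\<in>H.span B. hinner n d x (v - u) = 0"
    using insert.IH by blast
  obtain q where q: "q \<in> H.span B" "\<forall>x\<in>H.span B. hinner n d x (b - q) = 0"
    using insert.IH by blast
  define b' where "b' = b - q"
  define t where "t = hinner n d b' (v - u) / hinner n d b' b'"
  let ?u = "u + cscale t b'"
  have mono: "H.span B \<subseteq> H.span (insert b B)" by (rule H.span_mono) auto
  have b': "b' \<in> H.span (insert b B)"
    unfolding b'_def using mono q(1) by (intro H.span_diff) (auto intro: H.span_base)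
  have e: "hinner n d x (v - ?u) = hinner n d x (v - u) - t * hinner n d x b'" for x
    by (simp add: diff_diff_add[symmetric] hinner_linear)
  have perp: "hinner n d x (v - ?u) = 0" if "x \<in> H.span B" for x
    unfolding e using u(2) q(2) that by (simp add: b'_def)
  have "hinner n d b' (v - ?u) = 0"
  \<comment> \<open>\<open>hinner\<close> ignores entries outside \<open>idx n d\<close>, so a
    nonzero \<open>b'\<close> may have norm 0; it is then orthogonal to everything.\<close>
  proof (cases "hinner n d b' b' = 0")
    case True
    then have "\<forall>x\<in>idx n d. b' x = 0"
      using hinner_self_zero[of "\<lambda>x. if x \<in> idx n d then b' x else 0" n d]
      by (auto simp: hinner_def Hspace_def fun_eq_iff split: if_splits cong: sum.cong)
    then show ?thesis by (simp add: hinner_def)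
  qed (unfold e, simp add: t_def)
  have "hinner n d x (v - ?u) = 0" if x: "x \<in> H.span (insert b B)" for x
  proof -
    obtain k where k: "x - cscale k b \<in> H.span B" using x by (auto simp: H.span_insert)
    have eq: "x - cscale k b' = (x - cscale k b) + cscale k q"
      by (simp add: b'_def H.scale_right_diff_distrib)
    have "x - cscale k b' \<in> H.span B"
      unfolding eq by (intro H.span_add k H.span_scale q(1))
    from perp[OF this] have "hinner n d (x - cscale k b' + cscale k b') (v - ?u) = 0"
      unfolding hinner_linear(4,5) using \<open>hinner n d b' (v - ?u) = 0\<close> by simp
    then show ?thesis by simp
  qed
  moreover have "?u \<in> H.span (insert b B)"
    using u(1) mono b' by (intro H.span_add H.span_scale) auto
  ultimately show ?case by blast
qed

text \<open>The difference of \<open>v\<close> and its projection \<open>u\<close> to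
  \<open>D\<close> lies in the complement, so it is orthogonal to both \<open>v\<close> and
  \<open>u\<close>, hence to itself.\<close>

lemma mem_of_orthogonal_to_orth_compl:
  assumes D: "is_subspace_H n d D" and v: "v \<in> Hspace n d"
    and B: "orth_compl n d D \<subseteq> H.span B" and perp: "\<And>b. b \<in> B \<Longrightarrow> hinner n d b v = 0"
  shows "v \<in> D"
proof -
  have sub: "H.subspace D" "D \<subseteq> Hspace n d" using D by (auto simp: is_subspace_H_def)
  obtain E where E: "finite E" "E \<subseteq> D" "D \<subseteq> H.span E" "card E = cdim D"
    by (rule finite_spanning_subset[OF sub(2)])
  then have span: "H.span E = D" using sub(1) by (metis H.span_minimal subset_antisym)
  obtain u where u: "u \<in> D" "\<forall>b\<in>D. hinner n d b (v - u) = 0"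
    using orthogonal_projection[OF E(1)] span by metis
  have w: "v - u \<in> Hspace n d" using u(1) v sub(2) Hspace_subspace H.subspace_diff by blast
  then have "v - u \<in> orth_compl n d D" using u(2) by (simp add: orth_compl_def)
  then have "hinner n d (v - u) v = 0" using B hinner_span_zero[OF perp] by blast
  moreover have "hinner n d (v - u) u = 0" using u hinner_commute[of n d "v - u" u] by (metis complex_cnj_zero)
  ultimately have "hinner n d (v - u) (v - u) = 0" by (simp add: hinner_linear)
  then have "v - u = 0" by (rule hinner_self_zero[OF w])
  then show ?thesis using u(1) by simp
qed

section \<open>Coefficients and permanents\<close>

definition linform :: "nat \<Rightarrow> (nat \<Rightarrow> int) \<Rightarrow> ipoly" where
  "linform n c = (\<Sum>j<n. of_int (c j) * alpha j)"

lemma lookup_single_mult: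
  "Poly_Mapping.lookup (Poly_Mapping.single k a * p) m =
     a * Sum_any (\<lambda>q. Poly_Mapping.lookup p q when m = k + q)"
  by (simp add: lookup_mult lookup_single when_mult)

lemma lookup_alpha_mult:
  "Poly_Mapping.lookup (alpha j * p) (Poly_Mapping.single j 1 + m) = Poly_Mapping.lookup p m"
  unfolding alpha_def lookup_single_mult by (simp add: eq_commute)

lemma lookup_alpha_mult_nonzero:
  assumes "Poly_Mapping.lookup (alpha j * p) m \<noteq> 0"
  obtains m' where "m = Poly_Mapping.single j 1 + m'"
proof -
  have "\<exists>q. m = Poly_Mapping.single j 1 + q"
  proof (rule ccontr)
    assume "\<nexists>q. m = Poly_Mapping.single j 1 + q"
    then have "Sum_any (\<lambda>q. Poly_Mapping.lookup p q when m = Poly_Mapping.single j 1 + q) = 0"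
      by simp
    then show False using assms unfolding alpha_def lookup_single_mult by simp
  qed
  with that show thesis by blast
qed

text \<open>A monomial is encoded by a map \<open>s\<close> from slots to variables; the slots will
  index the points of the spheres.\<close>

definition slot_monomial :: "(nat \<Rightarrow> nat) \<Rightarrow> nat set \<Rightarrow> nat \<Rightarrow>\<^sub>0 nat" where
  "slot_monomial s B = (\<Sum>b\<in>B. Poly_Mapping.single (s b) 1)"

lemma lookup_slot_monomial:
  "finite B \<Longrightarrow> Poly_Mapping.lookup (slot_monomial s B) j = card {b \<in> B. s b = j}"
  by (simp add: slot_monomial_def lookup_sum lookup_single when_def sum.If_cases Int_def conj_commute)

lemma slot_monomial_remove:
  "finite B \<Longrightarrow> b \<in> B \<Longrightarrow> slot_monomial s B = Poly_Mapping.single (s b) 1 + slot_monomial s (B - {b})"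
  by (simp add: slot_monomial_def sum.remove)

lemma lookup_linform_mult:
  "Poly_Mapping.lookup (linform n c * p) m = (\<Sum>j<n. c j * Poly_Mapping.lookup (alpha j * p) m)"
proof -
  have "Poly_Mapping.lookup (of_int a * q) m = a * Poly_Mapping.lookup q m" for a and q :: ipoly
    by (simp flip: single_of_int add: lookup_single_mult)
  then show ?thesis
    by (simp add: linform_def sum_distrib_right lookup_sum mult.assoc)
qed

text \<open>A monomial occurring in a product of linear forms takes one variable from every
  factor.\<close>

lemma coefficient_slots:
  assumes "Poly_Mapping.lookup (prod_list (map (linform n) cs)) m \<noteq> 0"
  shows "\<exists>s. (\<forall>b<length cs. s b < n) \<and> m = slot_monomial s {..<length cs}"
  using assms
proof (induction cs arbitrary: m)
  case Nil
  then show ?case by (auto simp: slot_monomial_def lookup_one when_def split: if_splits)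
next
  case (Cons c cs)
  let ?p = "prod_list (map (linform n) cs)"
  have "(\<Sum>j<n. c j * Poly_Mapping.lookup (alpha j * ?p) m) \<noteq> 0"
    using Cons.prems by (simp add: lookup_linform_mult)
  then obtain j where j: "j < n" "Poly_Mapping.lookup (alpha j * ?p) m \<noteq> 0"
    by (metis (mono_tags, lifting) lessThan_iff mult_zero_right sum.neutral)
  then obtain m' where m': "m = Poly_Mapping.single j 1 + m'" using lookup_alpha_mult_nonzero by blast
  with j(2) have "Poly_Mapping.lookup ?p m' \<noteq> 0" using lookup_alpha_mult[of j ?p m'] by simp
  then obtain s where s: "\<forall>b<length cs. s b < n" "m' = slot_monomial s {..<length cs}"
    using Cons.IH by blast
  \<comment> \<open>The head of the list may take the last slot, since the monomial depends only on
    how often each variable is chosen.\<close>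
  let ?s = "s(length cs := j)"
  have "slot_monomial ?s {..<length (c # cs)} = m"
    unfolding m' s(2) slot_monomial_def by (simp add: lessThan_Suc)
  moreover have "\<forall>b<length (c # cs). ?s b < n"
    using s(1) j(1) by (auto simp: less_Suc_eq)
  ultimately show ?case by blast
qed

definition slot_factor :: "nat \<Rightarrow> (nat \<Rightarrow> nat) \<Rightarrow> nat set \<Rightarrow> int" where
  "slot_factor n s B = (\<Prod>j<n. fact (card {b \<in> B. s b = j}))"

lemma sum_slot_factor_remove:
  assumes "finite B" "j < n" "{b \<in> B. s b = j} \<noteq> {}"
  shows "(\<Sum>b | b \<in> B \<and> s b = j. slot_factor n s (B - {b})) = slot_factor n s B"
proof -
  let ?C = "\<lambda>B j. {b \<in> B. s b = j}"
  let ?R = "\<Prod>i\<in>{..<n} - {j}. fact (card (?C B i)) :: int"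
  have fact: "slot_factor n s (B - {b}) = fact (card (?C B j) - 1) * ?R" if "b \<in> ?C B j" for b
  proof -
    have "?C (B - {b}) j = ?C B j - {b}" "\<And>i. i \<noteq> j \<Longrightarrow> ?C (B - {b}) i = ?C B i"
      using that by auto
    then show ?thesis
      using assms(1,2) that unfolding slot_factor_def by (subst prod.remove[of _ j]) (auto simp: card_Diff_singleton)
  qed
  have "(\<Sum>b\<in>?C B j. slot_factor n s (B - {b})) = of_nat (card (?C B j)) * (fact (card (?C B j) - 1) * ?R)"
    using fact by simp
  also have "\<dots> = fact (card (?C B j)) * ?R"
    using assms by (subst (2) fact_reduce) (auto simp: card_gt_0_iff)
  also have "\<dots> = slot_factor n s B"
    using assms(2) unfolding slot_factor_def by (subst prod.remove[of _ j]) auto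
  finally show ?thesis by simp
qed

text \<open>Slots with the same variable give equal columns, so each choice of one variable per row
  that yields the monomial arises from \<open>slot_factor n s B\<close> bijections between rows and
  slots.\<close>

lemma permanent_eq_coefficient:
  assumes "finite B" "\<forall>b\<in>B. s b < n"
  shows "permanent (map (\<lambda>c b. c (s b)) cs) B =
     slot_factor n s B * Poly_Mapping.lookup (prod_list (map (linform n) cs)) (slot_monomial s B)"
  using assms
proof (induction cs arbitrary: B)
  case Nil
  show ?case
  proof (cases "B = {}")
    case False
    then obtain b where "b \<in> B" by blast
    then have "Poly_Mapping.lookup (slot_monomial s B) (s b) \<noteq> 0"
      using Nil by (auto simp: lookup_slot_monomial card_eq_0_iff)
    then have "slot_monomial s B \<noteq> 0" by auto
    then show ?thesis using False by (simp add: lookup_one)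
  qed (simp add: slot_factor_def slot_monomial_def)
next
  case (Cons c cs)
  let ?p = "prod_list (map (linform n) cs)"
  let ?L = "\<lambda>j. Poly_Mapping.lookup (alpha j * ?p) (slot_monomial s B)"
  have L: "Poly_Mapping.lookup ?p (slot_monomial s (B - {b})) = ?L (s b)" if "b \<in> B" for b
    using slot_monomial_remove[OF Cons.prems(1) that, of s] lookup_alpha_mult by metis
  have "permanent (map (\<lambda>c b. c (s b)) (c # cs)) B =
      (\<Sum>b\<in>B. c (s b) * (slot_factor n s (B - {b}) * ?L (s b)))"
    using Cons by (auto intro!: sum.cong simp: L)
  also have "\<dots> = (\<Sum>j<n. \<Sum>b | b \<in> B \<and> s b = j. c (s b) * (slot_factor n s (B - {b}) * ?L (s b)))"
    using Cons.prems by (intro sum.group[symmetric]) auto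
  also have "\<dots> = (\<Sum>j<n. c j * ?L j * (\<Sum>b | b \<in> B \<and> s b = j. slot_factor n s (B - {b})))"
    by (intro sum.cong refl) (auto simp: sum_distrib_left algebra_simps intro!: sum.cong)
  also have "\<dots> = (\<Sum>j<n. c j * ?L j * slot_factor n s B)"
  proof (intro sum.cong refl)
    fix j assume j: "j \<in> {..<n}"
    show "c j * ?L j * (\<Sum>b | b \<in> B \<and> s b = j. slot_factor n s (B - {b})) = c j * ?L j * slot_factor n s B"
    proof (cases "{b \<in> B. s b = j} = {}")
      \<comment> \<open>Without slots for \<open>j\<close> the monomial is not divisible by
        \<open>alpha j\<close>, so both sides vanish.\<close>
      case True
      then have "Poly_Mapping.lookup (slot_monomial s B) j = 0"
        using Cons.prems by (simp add: lookup_slot_monomial)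
      then have "?L j = 0"
        by (metis add_is_0 lookup_add lookup_alpha_mult_nonzero lookup_single_eq one_neq_zero)
      then show ?thesis by simp
    qed (use sum_slot_factor_remove[of B j n s] Cons.prems j in simp)
  qed
  also have "\<dots> = slot_factor n s B * Poly_Mapping.lookup (linform n c * ?p) (slot_monomial s B)"
    by (simp add: lookup_linform_mult sum_distrib_left algebra_simps)
  finally show ?case by simp
qed

interpretation ipoly: module "(*) :: ipoly \<Rightarrow> ipoly \<Rightarrow> ipoly"
  by unfold_locales (simp_all add: algebra_simps)

lemma alpha_power: "alpha j ^ k = Poly_Mapping.single (Poly_Mapping.single j k) 1"
  by (induction k) (simp_all add: alpha_def mult_single flip: single_add)

text \<open>Otherwise every monomial of \<open>p\<close> would be a multiple of some
  \<open>alpha j ^ d j\<close>, and \<open>p\<close> would lie in the ideal.\<close>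

lemma nonzero_in_quotient_coefficient:
  assumes "nonzero_in_quotient n d p"
  shows "\<exists>m. Poly_Mapping.lookup p m \<noteq> 0 \<and> (\<forall>j<n. Poly_Mapping.lookup m j < d j)"
proof (rule ccontr)
  assume neg: "\<not> ?thesis"
  have "Poly_Mapping.single m (Poly_Mapping.lookup p m) \<in> trunc_ideal n d"
    if m: "m \<in> Poly_Mapping.keys p" for m
  proof -
    obtain j where j: "j < n" "d j \<le> Poly_Mapping.lookup m j"
      using neg m by (force simp: in_keys_iff not_less)
    have "m = (m - Poly_Mapping.single j (d j)) + Poly_Mapping.single j (d j)"
      by (rule poly_mapping_eqI) (use j in \<open>auto simp: lookup_add lookup_minus lookup_single when_def\<close>)
    then have "Poly_Mapping.single m (Poly_Mapping.lookup p m) =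
        Poly_Mapping.single (m - Poly_Mapping.single j (d j)) (Poly_Mapping.lookup p m) * alpha j ^ d j"
      unfolding alpha_power mult_single by (metis mult.right_neutral)
    also have "\<dots> \<in> trunc_ideal n d"
      unfolding trunc_ideal_def by (intro ipoly.span_scale ipoly.span_base) (use j in auto)
    finally show ?thesis .
  qed
  moreover have "p = (\<Sum>m\<in>Poly_Mapping.keys p. Poly_Mapping.single m (Poly_Mapping.lookup p m))"
    by (rule poly_mapping_eqI)
      (auto simp: lookup_sum lookup_single when_def in_keys_iff)
  ultimately have "p \<in> trunc_ideal n d"
    unfolding trunc_ideal_def by (metis (no_types, lifting) ipoly.span_sum)
  with assms show False by (simp add: nonzero_in_quotient_def)
qed

section \<open>Product vectors from linear factors\<close>

text \<open>The constant coefficient vanishes on the boundary of the square, and both coefficients never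
  vanish simultaneously, so the projective class is constant on the boundary.\<close>

definition slot_poly :: "complex \<Rightarrow> complex poly" where
  "slot_poly z = [:of_real ((1 - (Re z)\<^sup>2) * (1 - (Im z)\<^sup>2)), z:]"

text \<open>By factorization into linear polynomials, unordered tuples of points of the Riemann
  sphere parametrize a projective space inside each tensor factor.\<close>

definition slot_vecs :: "nat \<Rightarrow> (nat \<Rightarrow> nat) \<Rightarrow> (nat \<Rightarrow> complex) \<Rightarrow> nat \<Rightarrow> nat \<Rightarrow> complex" where
  "slot_vecs K s z j = coeff (\<Prod>b | b < K \<and> s b = j. slot_poly (z b))"

lemma slot_poly_boundary:
  assumes "\<bar>Re z\<bar> = 1 \<or> \<bar>Im z\<bar> = 1" shows "slot_poly z = smult z (slot_poly 1)"
proof -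
  have "(Re z)\<^sup>2 = 1 \<or> (Im z)\<^sup>2 = 1" using assms by (metis one_power2 power2_abs)
  then have u: "(1 - (Re z)\<^sup>2) * (1 - (Im z)\<^sup>2) = 0" by auto
  show ?thesis unfolding slot_poly_def u by simp
qed

lemma slot_poly_nonzero: "slot_poly z \<noteq> 0"
  by (auto simp: slot_poly_def)

lemma slot_vecs_boundary:
  assumes "b < K" "\<bar>Re (z b)\<bar> = 1 \<or> \<bar>Im (z b)\<bar> = 1"
  shows "slot_vecs K s z j t = (if j = s b then z b else 1) * slot_vecs K s (z(b := 1)) j t"
proof (cases "j = s b")
  case True
  let ?B = "{b. b < K \<and> s b = j}"
  have b: "b \<in> ?B" "finite ?B" using True assms by auto
  have "(\<Prod>i\<in>?B. slot_poly (z i)) = slot_poly (z b) * (\<Prod>i\<in>?B - {b}. slot_poly (z i))"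
    using b by (simp add: prod.remove)
  also have "\<dots> = smult (z b) (slot_poly 1 * (\<Prod>i\<in>?B - {b}. slot_poly ((z(b := 1)) i)))"
    unfolding slot_poly_boundary[OF assms(2)] by simp
  also have "slot_poly 1 * (\<Prod>i\<in>?B - {b}. slot_poly ((z(b := 1)) i)) = (\<Prod>i\<in>?B. slot_poly ((z(b := 1)) i))"
    using b by (simp add: prod.remove[of ?B b])
  finally show ?thesis using True by (simp add: slot_vecs_def)
next
  case False
  then have "(\<Prod>i | i < K \<and> s i = j. slot_poly (z i)) = (\<Prod>i | i < K \<and> s i = j. slot_poly ((z(b := 1)) i))"
    by (intro prod.cong) auto
  then show ?thesis using False by (simp add: slot_vecs_def)
qed

lemma continuous_coeff_prod:
  fixes P :: "'b \<Rightarrow> 'a::topological_space \<Rightarrow> complex poly"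
  assumes "finite B" "\<And>b t. continuous_on UNIV (\<lambda>z. coeff (P b z) t)"
  shows "continuous_on UNIV (\<lambda>z. coeff (\<Prod>b\<in>B. P b z) t)"
  using assms(1)
proof (induction B arbitrary: t rule: finite_induct)
  case (insert b B)
  then show ?case
    by (simp add: coeff_mult) (intro continuous_on_sum continuous_on_mult assms(2); simp)
qed simp

lemma continuous_slot_vecs: "continuous_on UNIV (\<lambda>z. slot_vecs K s z j t)"
  unfolding slot_vecs_def
proof (rule continuous_coeff_prod)
  fix b t
  have "continuous_on UNIV (\<lambda>z :: nat \<Rightarrow> complex. z b)" by simp
  then show "continuous_on UNIV (\<lambda>z :: nat \<Rightarrow> complex. coeff (slot_poly (z b)) t)"
    unfolding slot_poly_def
    by (cases t; cases "t - 1") (auto intro!: continuous_intros)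
qed simp

lemma continuous_hinner_prodvec:
  "continuous_on UNIV (\<lambda>z. hinner n d w (prodvec n d (pconj T (slot_vecs K s z))))"
proof -
  have "continuous_on UNIV (\<lambda>z. pconj T (slot_vecs K s z) j t)" for j t
    unfolding pconj_def by (cases "j \<in> T") (auto intro!: continuous_intros continuous_slot_vecs)
  then have "continuous_on UNIV (\<lambda>z. prodvec n d (pconj T (slot_vecs K s z)) x)" for x
    unfolding prodvec_def by (cases "x \<in> idx n d") (auto intro!: continuous_intros)
  then show ?thesis unfolding hinner_def by (intro continuous_intros)
qed

text \<open>Slot \<open>b\<close> scales only the tensor factor \<open>s b\<close>, and the partial
  conjugation acts on this scalar. The product vector stands in the linear argument of
  \<open>hinner\<close>.\<close>

lemma hinner_prodvec_boundary:
  assumes b: "b < K" "s b < n" and z: "\<bar>Re (z b)\<bar> = 1 \<or> \<bar>Im (z b)\<bar> = 1"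
  shows "hinner n d w (prodvec n d (pconj T (slot_vecs K s z))) =
    twist (s b \<in> T) (z b) * hinner n d w (prodvec n d (pconj T (slot_vecs K s (z(b := 1)))))"
proof -
  let ?\<psi> = "slot_vecs K s z" and ?\<psi>' = "slot_vecs K s (z(b := 1))"
  have "pconj T ?\<psi> j t = (if j = s b then twist (s b \<in> T) (z b) else 1) * pconj T ?\<psi>' j t" for j t
    by (simp add: pconj_def slot_vecs_boundary[where z = z, OF b(1) z] twist_def)
  then have "(\<Prod>j<n. pconj T ?\<psi> j (x j)) = twist (s b \<in> T) (z b) * (\<Prod>j<n. pconj T ?\<psi>' j (x j))" for x
    using b(2) by (simp add: prod.distrib prod.delta)
  then have "prodvec n d (pconj T ?\<psi>) = cscale (twist (s b \<in> T) (z b)) (prodvec n d (pconj T ?\<psi>'))"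
    by (auto simp: prodvec_def cscale_def)
  then show ?thesis by (simp add: hinner_linear)
qed

lemma local_vecs_slot_vecs:
  assumes "\<forall>j<n. card {b. b < K \<and> s b = j} < d j"
  shows "local_vecs n d (slot_vecs K s z)" "prodvec n d (slot_vecs K s z) \<noteq> 0"
proof -
  define P where "P j = (\<Prod>b | b < K \<and> s b = j. slot_poly (z b))" for j
  have deg: "degree (P j) < d j" if "j < n" for j
  proof -
    have "degree (P j) \<le> (\<Sum>b | b < K \<and> s b = j. degree (slot_poly (z b)))"
      unfolding P_def using degree_prod_sum_le[of "{b. b < K \<and> s b = j}" "\<lambda>b. slot_poly (z b)"]
      by (simp add: comp_def)
    also have "\<dots> \<le> (\<Sum>b | b < K \<and> s b = j. 1)"
      by (intro sum_mono) (simp add: slot_poly_def)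
    also have "\<dots> < d j" using assms that by simp
    finally show ?thesis .
  qed
  show "local_vecs n d (slot_vecs K s z)"
    unfolding local_vecs_def
  proof (intro allI impI)
    fix j t assume "j < n" "d j \<le> t"
    then have "degree (P j) < t" using deg by (meson order_less_le_trans)
    then show "slot_vecs K s z j t = 0" by (simp add: slot_vecs_def P_def coeff_eq_0)
  qed
  \<comment> \<open>The entry at this multi-index is the product of the leading
    coefficients.\<close>
  let ?x = "\<lambda>j\<in>{..<n}. degree (P j)"
  have "?x \<in> idx n d" using deg by (auto simp: idx_def)
  moreover have "P j \<noteq> 0" for j by (simp add: P_def slot_poly_nonzero)
  ultimately have "prodvec n d (slot_vecs K s z) ?x \<noteq> 0"
    by (simp add: prodvec_def slot_vecs_def P_def[symmetric])
  then show "prodvec n d (slot_vecs K s z) \<noteq> 0" by auto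
qed

section \<open>From the polynomial condition to the product vector\<close>

lemma permanent_of_int:
  "permanent (map (\<lambda>r j. of_int (r j)) rs) J = (of_int (permanent rs J) :: 'a::comm_ring_1)"
  by (induction rs arbitrary: J) auto

lemma prod_list_concat_map_const:
  fixes f :: "nat \<Rightarrow> 'a::comm_monoid_mult"
  assumes "\<forall>i<r. length (ws i) = k i"
  shows "prod_list (map (\<lambda>(i, w). f i) (concat (map (\<lambda>i. map (Pair i) (ws i)) [0..<r]))) = (\<Prod>i<r. f i ^ k i)"
  using assms
proof (induction r)
  case (Suc r)
  have "prod_list (map (\<lambda>w. f r) xs) = f r ^ length xs" for xs :: "'b list"
    by (induction xs) auto
  then show ?case using Suc by (simp add: comp_def mult.commute)
qed simp

theorem theorem2p1:
  fixes n r :: nat and d :: "nat \<Rightarrow> nat" and S :: "nat \<Rightarrow> nat set"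
    and D :: "nat \<Rightarrow> hvec set" and k :: "nat \<Rightarrow> nat"
  assumes d_pos: "\<forall>j<n. 1 \<le> d j"
    and S_sub: "\<forall>i<r. S i \<subseteq> {..<n}"
    and D_sub: "\<forall>i<r. is_subspace_H n d (D i)"
    and k_def: "\<forall>i<r. k i = cdim (orth_compl n d (D i))"
    and nz: "nonzero_in_quotient n d
               (\<Prod>i<r. (\<Sum>j<n. of_int (sigma S i j) * alpha j) ^ k i)"
  shows "\<exists>\<psi>. local_vecs n d \<psi> \<and> prodvec n d \<psi> \<noteq> 0 \<and>
             (\<forall>i<r. prodvec n d (pconj (S i) \<psi>) \<in> D i)"
proof -
  have "\<exists>ws. length ws = k i \<and> orth_compl n d (D i) \<subseteq> H.span (set ws)" if "i < r" for i
  proof -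
    have "orth_compl n d (D i) \<subseteq> Hspace n d" by (auto simp: orth_compl_def)
    then obtain B where B: "finite B" "orth_compl n d (D i) \<subseteq> H.span B" "card B = k i"
      using finite_spanning_subset[of "orth_compl n d (D i)" n d] k_def \<open>i < r\<close> by metis
    then obtain ws where "set ws = B" "distinct ws" using finite_distinct_list by blast
    then show ?thesis using B distinct_card by metis
  qed
  then obtain ws where ws: "\<And>i. i < r \<Longrightarrow> length (ws i) = k i"
    "\<And>i. i < r \<Longrightarrow> orth_compl n d (D i) \<subseteq> H.span (set (ws i))" by metis
  \<comment> \<open>One equation for each \<open>i\<close> and each spanning vector of the
    complement of \<open>D i\<close>. Their number is the degree of the polynomial, so it is also
    the number of slots.\<close>
  define eqs where "eqs = concat (map (\<lambda>i. map (Pair i) (ws i)) [0..<r])"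
  define K where "K = length eqs"
  define cs where "cs = map (\<lambda>(i, w). sigma S i) eqs"
  have "prod_list (map (linform n) cs) = prod_list (map (\<lambda>(i, w). linform n (sigma S i)) eqs)"
    by (simp add: cs_def comp_def case_prod_unfold)
  also have "\<dots> = (\<Prod>i<r. linform n (sigma S i) ^ k i)"
    unfolding eqs_def using prod_list_concat_map_const[of r ws k] ws(1) by simp
  finally have "nonzero_in_quotient n d (prod_list (map (linform n) cs))"
    using nz by (simp add: linform_def)
  then obtain m where m: "Poly_Mapping.lookup (prod_list (map (linform n) cs)) m \<noteq> 0"
    "\<forall>j<n. Poly_Mapping.lookup m j < d j"
    using nonzero_in_quotient_coefficient by blast
  moreover have "length cs = K" by (simp add: cs_def K_def)
  ultimately obtain s where s: "\<forall>b<K. s b < n" "m = slot_monomial s {..<K}"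
    using coefficient_slots[OF m(1)] by auto
  have card: "\<forall>j<n. card {b. b < K \<and> s b = j} < d j"
    using m(2) by (simp add: s(2) lookup_slot_monomial)
  have "slot_factor n s {..<K} \<noteq> 0" by (simp add: slot_factor_def)
  then have perm: "permanent (map (\<lambda>c b. c (s b)) cs) {..<K} \<noteq> 0"
    using permanent_eq_coefficient[of "{..<K}" s n cs] m(1) s by simp
  \<comment> \<open>Equation \<open>e\<close> picks up the conjugate of \<open>z b\<close> exactly
    if its partial conjugation affects the tensor factor of slot \<open>b\<close>.\<close>
  define c where "c e b \<longleftrightarrow> s b \<in> S (fst (eqs ! e))" for e b
  define F where "F e z = hinner n d (snd (eqs ! e)) (prodvec n d (pconj (S (fst (eqs ! e))) (slot_vecs K s z)))"
    for e z
  interpret equivariant_system K c F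
  proof
    fix e b z
    assume "b < K" "\<bar>Re (z b)\<bar> = 1 \<or> \<bar>Im (z b)\<bar> = 1"
    then show "F e z = twist (c e b) (z b) * F e (z(b := 1))"
      unfolding F_def c_def using s(1) by (intro hinner_prodvec_boundary) auto
  qed
  have "map (\<lambda>e b. if c e b then - 1 else 1 :: real) [0..<K] =
      map (\<lambda>r j. of_int (r j)) (map (\<lambda>c b. c (s b)) cs)"
    by (rule nth_equalityI) (auto simp: cs_def K_def c_def sigma_def fun_eq_iff case_prod_unfold)
  then have "permanent (map (\<lambda>e b. if c e b then - 1 else 1 :: real) [0..<K]) {..<K} \<noteq> 0"
    using perm by (simp only: permanent_of_int of_int_eq_0_iff) simp
  then obtain z where z: "\<forall>e<K. F e z = 0"
    using common_zero continuous_hinner_prodvec unfolding F_def by blast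
  let ?\<psi> = "slot_vecs K s z"
  have "prodvec n d (pconj (S i) ?\<psi>) \<in> D i" if i: "i < r" for i
  proof (rule mem_of_orthogonal_to_orth_compl)
    show "is_subspace_H n d (D i)" using D_sub i by blast
    show "prodvec n d (pconj (S i) ?\<psi>) \<in> Hspace n d" by (simp add: Hspace_def prodvec_def)
    show "orth_compl n d (D i) \<subseteq> H.span (set (ws i))" using ws(2) i by blast
    fix w assume "w \<in> set (ws i)"
    then have "(i, w) \<in> set eqs" using i by (auto simp: eqs_def)
    then obtain e where "e < K" "eqs ! e = (i, w)" by (auto simp: in_set_conv_nth K_def)
    then show "hinner n d w (prodvec n d (pconj (S i) ?\<psi>)) = 0" using z by (force simp: F_def)
  qed
  then show ?thesis using local_vecs_slot_vecs[OF card] by blast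
qed

end
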